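(* Let $r$ be a $C^4$-class plane curve with a unique, degenerate equilibrium point $m$ with respect to the origin $o$, and let $E$ denote the evolute of $r$. Let $o(t)=(\mu t,\nu t)$, where $(\mu,\nu)\ne(0,0)$ and $t\in[-\varepsilon,\varepsilon]$ for some small value of $\varepsilon>0$. Let $N^0(t)$ denote the number of local equilibria (the sum of the imaginary equilibrium indices) of $r$ with respect to $o(t)$. Then the following holds. (i) If the curve $o(t)$ crosses the evolute $E$ of $r$ at $o$, and $E$ is locally convex at $o$ such that for $t>0$, $o(t)$ is on the concave side of $E$, then $N^0(t)=0$ as $t\to 0-0$, and $N^0(t)=\Theta\left(\frac{1}{\sqrt{t}}\right)$ as $t\to 0+0$. (ii) If $o(t)$ is tangent to the evolute $E$ of $r$ at $o$, and $E$ is locally convex at $o$, then $N^0(t)=\Theta\left(\frac{1}{|t|}\right)$ as $t\to 0$. (iii) If $o$ is a generic cusp of $E$ and $o(t)$ is not tangent to $E$ at $o$, then $N^0(t)=\Theta\left(\frac{1}{\sqrt[3]{t^2}}\right)$ as $t\to 0$. (iv) If $o$ is a generic cusp of $E$ and $o(t)$ is tangent to $E$ at $o$, then $N^0(t)=\Theta\left(\frac{1}{|t|}\right)$ as $t\to 0$.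
   Context: An equilibrium point of $r$ with respect to a point $q$ is a critical point $m$ of the distance function $\tau\mapsto|r(\tau)-q|$. With $\rho=|m-q|$ and $\kappa$ the signed curvature of $r$ at $m$ taken with respect to the normal vector $(m-q)/\rho$ (negative if the curve bends toward $q$), $m$ is degenerate iff $1+\kappa\rho=0$. The imaginary equilibrium indices of a non-degenerate equilibrium point are $S^0=\frac{1}{|1+\kappa\rho|}$ and $U^0=\frac{|\kappa\rho|}{|1+\kappa\rho|}$. $N^0(t)$ is the sum of $S^0+U^0=\frac{1+|\kappa\rho|}{|1+\kappa\rho|}$ over all equilibrium points of $r$ with respect to $o(t)$. The evolute $E$ is the curve of centers of curvature of $r$; since $m$ is degenerate with respect to $o$, the origin $o$ is the point of $E$ corresponding to $m$. A point of $E$ is general if it is not a cusp and $E$ passes through it for only one parameter value. $E$ is locally convex at a general point if that point has a neighborhood $V$ such that $E\cap V$ is a strictly convex curve; the convex connected region of $(\mathbb{R}^2\setminus E)\cap V$ is then the convex side of $E$ and the other region is the concave side. Standing assumption: in (i) and (ii) $o$ is a generic point of $E$, meaning that the derivative of the curvature of $r$ at $m$ is nonzero; if $o$ is a cusp of $E$ (cases (iii), (iv)), it is a generic cusp, meaning that the first derivative of the curvature of $r$ vanishes at $m$ and the second derivative of the curvature of $r$ at $m$ is nonzero. $g(t)=\Theta(h(t))$ as $t\to 0$ means that there are constants $C_1,C_2>0$ with $C_1h(t)\le g(t)\le C_2h(t)$ for all $t\neq 0$ sufficiently close to $0$ (on the indicated side). *)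

theory Defs
  imports "HOL-Analysis.Analysis"
begin

type_synonym plane = "real \<times> real"

(* C^k on a set of parameters; at the endpoints of a closed interval the derivatives are
   one-sided. *)
primrec Ck_on :: "nat \<Rightarrow> (real \<Rightarrow> 'a::real_normed_vector) \<Rightarrow> real set \<Rightarrow> bool" where
  "Ck_on 0 f I \<longleftrightarrow> continuous_on I f"
| "Ck_on (Suc k) f I \<longleftrightarrow>
     (\<exists>f'. (\<forall>s\<in>I. (f has_vector_derivative f' s) (at s within I)) \<and> Ck_on k f' I)"

definition velocity :: "(real \<Rightarrow> plane) \<Rightarrow> real set \<Rightarrow> real \<Rightarrow> plane" where
  "velocity r I s = vector_derivative r (at s within I)"

definition acceleration :: "(real \<Rightarrow> plane) \<Rightarrow> real set \<Rightarrow> real \<Rightarrow> plane" where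
  "acceleration r I s = vector_derivative (velocity r I) (at s within I)"

definition regular_Ck_curve :: "nat \<Rightarrow> (real \<Rightarrow> plane) \<Rightarrow> real set \<Rightarrow> bool" where
  "regular_Ck_curve k r I \<longleftrightarrow> Ck_on k r I \<and> (\<forall>s\<in>I. velocity r I s \<noteq> 0)"

definition rot90 :: "plane \<Rightarrow> plane" where
  "rot90 v = (- snd v, fst v)"

definition det2 :: "plane \<Rightarrow> plane \<Rightarrow> real" where
  "det2 v w = fst v * snd w - snd v * fst w"

definition unit_normal :: "(real \<Rightarrow> plane) \<Rightarrow> real set \<Rightarrow> real \<Rightarrow> plane" where
  "unit_normal r I s = rot90 (velocity r I s) /\<^sub>R norm (velocity r I s)"

(* Signed curvature with respect to unit_normal: the curvature vector of r is
   curvature r I s *\<^sub>R unit_normal r I s. *)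
definition curvature :: "(real \<Rightarrow> plane) \<Rightarrow> real set \<Rightarrow> real \<Rightarrow> real" where
  "curvature r I s = det2 (velocity r I s) (acceleration r I s) / norm (velocity r I s) ^ 3"

(* Critical points of the distance function, identified by their parameters. The distance
   function is not differentiable where it vanishes; such parameters count as critical too,
   which also covers an endpoint of I, where a one-sided derivative exists. *)
definition equilibria :: "(real \<Rightarrow> plane) \<Rightarrow> real set \<Rightarrow> plane \<Rightarrow> real set" where
  "equilibria r I q = {s \<in> I. r s = q \<or>
     ((\<lambda>u. norm (r u - q)) has_real_derivative 0) (at s within I)}"

(* Curvature with respect to the normal (r s - q) / |r s - q|: the component of the curvature
   vector along it. At an equilibrium off q this normal is unit_normal up to sign. *)
definition curvature_wrt :: "(real \<Rightarrow> plane) \<Rightarrow> real set \<Rightarrow> plane \<Rightarrow> real \<Rightarrow> real" where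
  "curvature_wrt r I q s =
     curvature r I s * (unit_normal r I s \<bullet> ((r s - q) /\<^sub>R norm (r s - q)))"

definition kappa_rho :: "(real \<Rightarrow> plane) \<Rightarrow> real set \<Rightarrow> plane \<Rightarrow> real \<Rightarrow> real" where
  "kappa_rho r I q s = curvature_wrt r I q s * norm (r s - q)"

definition degenerate :: "(real \<Rightarrow> plane) \<Rightarrow> real set \<Rightarrow> plane \<Rightarrow> real \<Rightarrow> bool" where
  "degenerate r I q s \<longleftrightarrow> 1 + kappa_rho r I q s = 0"

(* The indices live in ennreal, where 1 / 0 = \<infinity>. Hence N0 is infinite if some equilibrium is
   degenerate or if there are infinitely many equilibria (each contributes at least 1), and a
   finite bound on N0 excludes both. *)
definition S0 :: "(real \<Rightarrow> plane) \<Rightarrow> real set \<Rightarrow> plane \<Rightarrow> real \<Rightarrow> ennreal" where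
  "S0 r I q s = 1 / ennreal \<bar>1 + kappa_rho r I q s\<bar>"

definition U0 :: "(real \<Rightarrow> plane) \<Rightarrow> real set \<Rightarrow> plane \<Rightarrow> real \<Rightarrow> ennreal" where
  "U0 r I q s = ennreal \<bar>kappa_rho r I q s\<bar> / ennreal \<bar>1 + kappa_rho r I q s\<bar>"

definition N0 :: "(real \<Rightarrow> plane) \<Rightarrow> real set \<Rightarrow> plane \<Rightarrow> ennreal" where
  "N0 r I q = (\<Sum>\<^sub>\<infinity>s\<in>equilibria r I q. S0 r I q s + U0 r I q s)"

(* Meaningful only where the curvature is nonzero. *)
definition curvature_center :: "(real \<Rightarrow> plane) \<Rightarrow> real set \<Rightarrow> real \<Rightarrow> plane" where
  "curvature_center r I s = r s + (1 / curvature r I s) *\<^sub>R unit_normal r I s"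

definition evolute_params :: "(real \<Rightarrow> plane) \<Rightarrow> real set \<Rightarrow> real set" where
  "evolute_params r I = {s \<in> I. curvature r I s \<noteq> 0}"

definition evolute :: "(real \<Rightarrow> plane) \<Rightarrow> real set \<Rightarrow> plane set" where
  "evolute r I = curvature_center r I ` evolute_params r I"

definition evolute_cusp :: "(real \<Rightarrow> plane) \<Rightarrow> real set \<Rightarrow> real \<Rightarrow> bool" where
  "evolute_cusp r I s \<longleftrightarrow> (curvature_center r I has_vector_derivative 0) (at s within I)"

definition generic_evolute_point :: "(real \<Rightarrow> plane) \<Rightarrow> real set \<Rightarrow> real \<Rightarrow> bool" where
  "generic_evolute_point r I s \<longleftrightarrow> deriv (curvature r I) s \<noteq> 0"

definition generic_evolute_cusp :: "(real \<Rightarrow> plane) \<Rightarrow> real set \<Rightarrow> real \<Rightarrow> bool" where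
  "generic_evolute_cusp r I s \<longleftrightarrow> evolute_cusp r I s \<and>
     deriv (curvature r I) s = 0 \<and> deriv (deriv (curvature r I)) s \<noteq> 0"

definition general_evolute_point :: "(real \<Rightarrow> plane) \<Rightarrow> real set \<Rightarrow> real \<Rightarrow> bool" where
  "general_evolute_point r I s \<longleftrightarrow> \<not> evolute_cusp r I s \<and>
     {u \<in> evolute_params r I. curvature_center r I u = curvature_center r I s} = {s}"

(* An open arc on the boundary of a convex set, with no three distinct collinear points. *)
definition strictly_convex_curve :: "plane set \<Rightarrow> bool" where
  "strictly_convex_curve S \<longleftrightarrow>
     S homeomorphic {0<..<1::real} \<and>
     S \<subseteq> frontier (convex hull S) \<and>
     (\<forall>x\<in>S. \<forall>y\<in>S. open_segment x y \<inter> S = {})"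

(* V is a neighborhood witnessing local convexity of the evolute at the general point with
   parameter s; A is the convex side and B the concave side. *)
definition evolute_sides ::
  "(real \<Rightarrow> plane) \<Rightarrow> real set \<Rightarrow> real \<Rightarrow> plane set \<Rightarrow> plane set \<Rightarrow> plane set \<Rightarrow> bool" where
  "evolute_sides r I s V A B \<longleftrightarrow>
     general_evolute_point r I s \<and>
     open V \<and> curvature_center r I s \<in> V \<and>
     strictly_convex_curve (evolute r I \<inter> V) \<and>
     components (V - evolute r I) = {A, B} \<and> A \<noteq> B \<and> convex A"

definition evolute_locally_convex :: "(real \<Rightarrow> plane) \<Rightarrow> real set \<Rightarrow> real \<Rightarrow> bool" where
  "evolute_locally_convex r I s \<longleftrightarrow> (\<exists>V A B. evolute_sides r I s V A B)"

(* The line with direction v through the evolute point with parameter s is the limit of secants,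
   i.e. the sine of the angle between v and the secant tends to 0. Unlike parallelism to the
   derivative of the evolute, this makes sense at a cusp as well. *)
definition evolute_tangent :: "(real \<Rightarrow> plane) \<Rightarrow> real set \<Rightarrow> real \<Rightarrow> plane \<Rightarrow> bool" where
  "evolute_tangent r I s v \<longleftrightarrow> v \<noteq> 0 \<and>
     ((\<lambda>u. \<bar>det2 v (curvature_center r I u - curvature_center r I s)\<bar>
             / (norm v * norm (curvature_center r I u - curvature_center r I s)))
        \<longlongrightarrow> 0) (at s within I)"

definition is_Theta :: "real filter \<Rightarrow> (real \<Rightarrow> ennreal) \<Rightarrow> (real \<Rightarrow> real) \<Rightarrow> bool" where
  "is_Theta F g h \<longleftrightarrow> (\<exists>C1>0. \<exists>C2>0. \<forall>\<^sub>F t in F.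
     ennreal (C1 * h t) \<le> g t \<and> g t \<le> ennreal (C2 * h t))"

end

theory Submission
  imports Defs
begin

text \<open>
  Let F(s,q) = (r(s) - q) \<bullet> r'(s), half the derivative of the squared distance to q. The equilibria with
  respect to q are the zeros of F(-,q), and at a zero 1 + \<kappa> \<rho> = F_s / |r'|^2 (index_denominator). An
  equilibrium close to degeneracy thus contributes about 2 |r'|^2 / |F_s| to N0, and the order of N0
  is that of 1 / |F_s| at the zeros (N0_Theta). By compactness all zeros are close to m when q is close
  to the origin (equilibria_localized).

  For q = t w one has F = f - t g with f(s) = r \<bullet> r' and g(s) = w \<bullet> r'. Degeneracy of m means
  f(m) = f'(m) = 0. Up to nonzero factors, f''(m) is the derivative of the curvature at m and, if this
  vanishes, f'''(m) is its second derivative. So f vanishes to order j = 2 at a generic point of the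
  evolute and to order j = 3 at a generic cusp. The evolute is tangent to the normal of the curve
  (evolute_tangent_iff), so g vanishes to order i = 1 if w is tangent to the evolute and to order
  i = 0 if not. At a zero s different from m,

    t = f/g is of order (s - m)^(j - i), and F_s = f' - (f/g) g' is of order (s - m)^(j - 1),

  so |F_s| is of order |t|^((j - 1)/(j - i)). The exponents in the four cases are 1/2, 1, 2/3 and 1.
  Since f/g is monotone on each side of m, there are at most three zeros (root_slope_scaling,
  equilibria_near_m). A zero exists because of a sign change (equilibrium_exists) or, in the tangent
  cases, because m itself is one.

  In the first case it remains to decide for which sign of t the zeros exist, that is, to deduce
  f''(m) g(m) > 0 from the position of the path relative to the convex side of the evolute. This is
  done in evolute_sides_crossing, using that F is affine in q.
\<close>

section \<open>Zeros of a pencil of functions near a multiple zero\<close>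

text \<open>
  L'Hopital's rule lifts the leading coefficient of a derivative to that of the function. Applied
  repeatedly, it replaces Taylor expansions and uses the highest derivative only at the point m.
\<close>

lemma antiderivative_quotient_limit:
  fixes h h' :: "real \<Rightarrow> real"
  assumes deriv: "\<forall>\<^sub>F s in nhds m. (h has_real_derivative h' s) (at s)"
    and "h m = 0"
    and lim: "((\<lambda>s. h' s / (s - m) ^ n) \<longlongrightarrow> L) (at m)"
  shows "((\<lambda>s. h s / (s - m) ^ Suc n) \<longlongrightarrow> L / real (Suc n)) (at m)"
proof (rule lhopital)
  have "isCont h m"
    using eventually_nhds_x_imp_x[OF deriv] by (rule DERIV_isCont)
  then show "(h \<longlongrightarrow> 0) (at m)"
    using \<open>h m = 0\<close> by (simp add: isCont_def)
  show "((\<lambda>s. (s - m) ^ Suc n) \<longlongrightarrow> 0) (at m)"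
    by (rule tendsto_eq_intros refl | simp)+
  have ne: "\<forall>\<^sub>F s in at m. s \<noteq> m"
    by (simp add: eventually_at_filter)
  show "\<forall>\<^sub>F s in at m. (s - m) ^ Suc n \<noteq> 0"
    using ne by eventually_elim simp
  show "\<forall>\<^sub>F s in at m. real (Suc n) * (s - m) ^ n \<noteq> 0"
    using ne by eventually_elim simp
  show "\<forall>\<^sub>F s in at m. (h has_real_derivative h' s) (at s)"
    using deriv by (auto simp: eventually_at_filter elim: eventually_mono)
  show "\<forall>\<^sub>F s in at m. ((\<lambda>s. (s - m) ^ Suc n) has_real_derivative real (Suc n) * (s - m) ^ n) (at s)"
  proof (intro always_eventually allI)
    fix s
    show "((\<lambda>s. (s - m) ^ Suc n) has_real_derivative real (Suc n) * (s - m) ^ n) (at s)"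
      by (rule DERIV_cong[OF DERIV_power_Suc[where D = 1]]) (auto intro!: derivative_eq_intros)
  qed
  have "((\<lambda>s. h' s / (s - m) ^ n / real (Suc n)) \<longlongrightarrow> L / real (Suc n)) (at m)"
    by (intro tendsto_divide lim tendsto_const) simp
  then show "((\<lambda>s. h' s / (real (Suc n) * (s - m) ^ n)) \<longlongrightarrow> L / real (Suc n)) (at m)"
    by (simp add: field_simps)
qed

lemma derivative_quotient_limit:
  fixes h :: "real \<Rightarrow> real"
  assumes "(h has_real_derivative L) (at m)" "h m = 0"
  shows "((\<lambda>s. h s / (s - m)) \<longlongrightarrow> L) (at m)"
  using assms by (simp add: has_field_derivative_iff)

lemma eventually_abs_bounds:
  fixes h :: "'a \<Rightarrow> real"
  assumes "(h \<longlongrightarrow> L) F" "L \<noteq> 0"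
  shows "\<forall>\<^sub>F x in F. \<bar>L\<bar> / 2 \<le> \<bar>h x\<bar> \<and> \<bar>h x\<bar> \<le> 2 * \<bar>L\<bar>"
proof -
  have "((\<lambda>x. \<bar>h x\<bar>) \<longlongrightarrow> \<bar>L\<bar>) F"
    using assms(1) by (rule tendsto_rabs)
  moreover have "\<bar>L\<bar> / 2 < \<bar>L\<bar>" "\<bar>L\<bar> < 2 * \<bar>L\<bar>"
    using assms(2) by auto
  ultimately have "\<forall>\<^sub>F x in F. \<bar>L\<bar> / 2 < \<bar>h x\<bar>" "\<forall>\<^sub>F x in F. \<bar>h x\<bar> < 2 * \<bar>L\<bar>"
    using order_tendstoD[of "\<lambda>x. \<bar>h x\<bar>" "\<bar>L\<bar>" F] by blast+
  then show ?thesis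
    by eventually_elim simp
qed

text \<open>
  If f vanishes at m to order j and g to the smaller order i, then the solutions s of f s = t g s
  near m satisfy t = f s / g s, which is of exact order (s - m)^(j - i). The slope f' - t g' of
  f - t g at such a solution is f' - (f/g) g', whose leading term is (j - i) A (s - m)^(j - 1): the
  leading terms of f' and of (f/g) g' cannot cancel because i and j differ. Eliminating s - m gives
  the exponent e. The same computation shows that f/g has no critical point near m other than m, so
  by Rolle it takes every value at most once on each side of m. The sign in the last conjunct tells
  on which side of m the solution lies.
\<close>

lemma root_slope_scaling:
  fixes f f1 g g1 :: "real \<Rightarrow> real" and A B m :: real and i j :: nat
  defines "e \<equiv> (real j - 1) / (real j - real i)"
  assumes "i < j" "A \<noteq> 0" "B \<noteq> 0"
    and df: "\<forall>\<^sub>F s in nhds m. (f has_real_derivative f1 s) (at s)"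
    and dg: "\<forall>\<^sub>F s in nhds m. (g has_real_derivative g1 s) (at s)"
    and lf: "((\<lambda>s. f s / (s - m) ^ j) \<longlongrightarrow> A) (at m)"
    and lf1: "((\<lambda>s. f1 s / (s - m) ^ (j - 1)) \<longlongrightarrow> real j * A) (at m)"
    and lg: "((\<lambda>s. g s / (s - m) ^ i) \<longlongrightarrow> B) (at m)"
    and lg1: "((\<lambda>s. g1 s * (s - m) / (s - m) ^ i) \<longlongrightarrow> real i * B) (at m)"
  obtains \<eta> c C where "\<eta> > 0" "c > 0" "C > 0"
    and "\<And>s t. 0 < \<bar>s - m\<bar> \<Longrightarrow> \<bar>s - m\<bar> < \<eta> \<Longrightarrow> f s = t * g s \<Longrightarrow>
           c * \<bar>t\<bar> powr e \<le> \<bar>f1 s - t * g1 s\<bar> \<and> \<bar>f1 s - t * g1 s\<bar> \<le> C * \<bar>t\<bar> powr e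
           \<and> A * B * t * (s - m) ^ (j - i) > 0"
    and "\<And>s s' t. m < s \<and> m < s' \<or> s < m \<and> s' < m \<Longrightarrow> \<bar>s - m\<bar> < \<eta> \<Longrightarrow> \<bar>s' - m\<bar> < \<eta> \<Longrightarrow>
           f s = t * g s \<Longrightarrow> f s' = t * g s' \<Longrightarrow> s = s'"
proof -
  have "1 \<le> j" using \<open>i < j\<close> by simp
  \<comment> \<open>The equation \<open>f s = t * g s\<close> reads \<open>\<phi> s = t\<close>; at a solution, \<open>\<psi> s\<close> is \<open>f1 s - t * g1 s\<close>,
      and \<open>\<psi> s / g s\<close> is the derivative of \<open>\<phi>\<close>.\<close>
  define \<phi> where "\<phi> = (\<lambda>s. f s / g s)"
  define \<psi> where "\<psi> = (\<lambda>s. f1 s - \<phi> s * g1 s)"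
  have ne: "\<forall>\<^sub>F s in at m. s \<noteq> m"
    by (simp add: eventually_at_filter)
  have l\<phi>: "((\<lambda>s. \<phi> s / (s - m) ^ (j - i)) \<longlongrightarrow> A / B) (at m)"
  proof (rule Lim_transform_eventually[OF tendsto_divide[OF lf lg \<open>B \<noteq> 0\<close>]])
    show "\<forall>\<^sub>F s in at m. f s / (s - m) ^ j / (g s / (s - m) ^ i) = \<phi> s / (s - m) ^ (j - i)"
      using ne by eventually_elim (use \<open>i < j\<close> in \<open>simp add: \<phi>_def power_diff\<close>)
  qed
  have "((\<lambda>s. f1 s / (s - m) ^ (j - 1) - \<phi> s / (s - m) ^ (j - i) * (g1 s * (s - m) / (s - m) ^ i))
          \<longlongrightarrow> real j * A - A / B * (real i * B)) (at m)"
    by (intro tendsto_intros lf1 l\<phi> lg1)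
  then have "((\<lambda>s. \<psi> s / (s - m) ^ (j - 1)) \<longlongrightarrow> real j * A - A / B * (real i * B)) (at m)"
  proof (rule Lim_transform_eventually)
    have eq: "(f1 s / x ^ (j - 1) - \<phi> s / x ^ (j - i) * (g1 s * x / x ^ i)) = \<psi> s / x ^ (j - 1)"
      if "x \<noteq> 0" for x s :: real
    proof -
      have "x ^ (j - i) * x ^ i = x ^ (j - 1) * x"
        using \<open>i < j\<close> by (simp flip: power_add power_Suc2)
      then have "\<phi> s / x ^ (j - i) * (g1 s * x / x ^ i) = \<phi> s * g1 s * x / (x ^ (j - 1) * x)"
        by simp
      then show ?thesis
        using that by (simp add: \<psi>_def diff_divide_distrib)
    qed
    show "\<forall>\<^sub>F s in at m. f1 s / (s - m) ^ (j - 1) - \<phi> s / (s - m) ^ (j - i) * (g1 s * (s - m) / (s - m) ^ i)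
      = \<psi> s / (s - m) ^ (j - 1)"
      using ne by eventually_elim (rule eq, simp)
  qed
  moreover have "real j * A - A / B * (real i * B) = (real j - real i) * A"
    using \<open>B \<noteq> 0\<close> by (simp add: field_simps)
  ultimately have l\<psi>: "((\<lambda>s. \<psi> s / (s - m) ^ (j - 1)) \<longlongrightarrow> (real j - real i) * A) (at m)"
    by simp
  have nzA: "A / B \<noteq> 0" "(real j - real i) * A \<noteq> 0"
    using \<open>A \<noteq> 0\<close> \<open>B \<noteq> 0\<close> \<open>i < j\<close> by auto
  define K where "K = \<bar>A / B\<bar>"
  define L where "L = \<bar>(real j - real i) * A\<bar>"
  have KL: "K > 0" "L > 0" using nzA by (auto simp: K_def L_def)
  have e: "e \<ge> 0" using \<open>1 \<le> j\<close> \<open>i < j\<close> by (simp add: e_def)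
  have "\<forall>\<^sub>F s in at m. (f has_real_derivative f1 s) (at s) \<and> (g has_real_derivative g1 s) (at s)"
    using df dg by (auto simp: eventually_at_filter elim: eventually_elim2)
  moreover have "\<forall>\<^sub>F s in at m. \<bar>B\<bar> / 2 \<le> \<bar>g s / (s - m) ^ i\<bar> \<and> \<bar>g s / (s - m) ^ i\<bar> \<le> 2 * \<bar>B\<bar>"
    by (rule eventually_abs_bounds[OF lg \<open>B \<noteq> 0\<close>])
  moreover have "\<forall>\<^sub>F s in at m. K / 2 \<le> \<bar>\<phi> s / (s - m) ^ (j - i)\<bar> \<and> \<bar>\<phi> s / (s - m) ^ (j - i)\<bar> \<le> 2 * K"
    unfolding K_def by (rule eventually_abs_bounds[OF l\<phi> nzA(1)])
  moreover have "\<forall>\<^sub>F s in at m. L / 2 \<le> \<bar>\<psi> s / (s - m) ^ (j - 1)\<bar> \<and> \<bar>\<psi> s / (s - m) ^ (j - 1)\<bar> \<le> 2 * L"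
    unfolding L_def by (rule eventually_abs_bounds[OF l\<psi> nzA(2)])
  moreover have "\<forall>\<^sub>F s in at m. A / B * (\<phi> s / (s - m) ^ (j - i)) > 0"
    by (rule order_tendstoD(1)[OF tendsto_mult[OF tendsto_const l\<phi>]]) (use nzA(1) in \<open>metis not_real_square_gt_zero\<close>)
  ultimately have "\<forall>\<^sub>F s in at m. (f has_real_derivative f1 s) (at s) \<and> (g has_real_derivative g1 s) (at s)
      \<and> \<bar>B\<bar> / 2 \<le> \<bar>g s / (s - m) ^ i\<bar>
      \<and> K / 2 \<le> \<bar>\<phi> s / (s - m) ^ (j - i)\<bar> \<and> \<bar>\<phi> s / (s - m) ^ (j - i)\<bar> \<le> 2 * K
      \<and> L / 2 \<le> \<bar>\<psi> s / (s - m) ^ (j - 1)\<bar> \<and> \<bar>\<psi> s / (s - m) ^ (j - 1)\<bar> \<le> 2 * L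
      \<and> A / B * (\<phi> s / (s - m) ^ (j - i)) > 0"
    by eventually_elim auto
  then obtain \<eta> where \<eta>: "\<eta> > 0" and H: "\<And>s. s \<noteq> m \<Longrightarrow> \<bar>s - m\<bar> < \<eta> \<Longrightarrow>
      (f has_real_derivative f1 s) (at s) \<and> (g has_real_derivative g1 s) (at s)
      \<and> \<bar>B\<bar> / 2 \<le> \<bar>g s / (s - m) ^ i\<bar>
      \<and> K / 2 \<le> \<bar>\<phi> s / (s - m) ^ (j - i)\<bar> \<and> \<bar>\<phi> s / (s - m) ^ (j - i)\<bar> \<le> 2 * K
      \<and> L / 2 \<le> \<bar>\<psi> s / (s - m) ^ (j - 1)\<bar> \<and> \<bar>\<psi> s / (s - m) ^ (j - 1)\<bar> \<le> 2 * L
      \<and> A / B * (\<phi> s / (s - m) ^ (j - i)) > 0"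
    by (auto simp: eventually_at dist_real_def)
  have gnz: "g s \<noteq> 0" if "s \<noteq> m" "\<bar>s - m\<bar> < \<eta>" for s
    using H[OF that] \<open>B \<noteq> 0\<close> by auto
  have \<psi>nz: "\<psi> s \<noteq> 0" if "s \<noteq> m" "\<bar>s - m\<bar> < \<eta>" for s
    using H[OF that] KL by auto
  have d\<phi>: "(\<phi> has_real_derivative \<psi> s / g s) (at s)" if "s \<noteq> m" "\<bar>s - m\<bar> < \<eta>" for s
    using H[OF that] gnz[OF that]
    by (auto intro!: derivative_eq_intros simp: \<phi>_def \<psi>_def field_simps)
  have \<phi>eq: "\<phi> s = t" if "s \<noteq> m" "\<bar>s - m\<bar> < \<eta>" "f s = t * g s" for s t
    using gnz[OF that(1,2)] that(3) by (simp add: \<phi>_def)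
  have inj: False if "s < s'" "m < s \<or> s' < m" "\<bar>s - m\<bar> < \<eta>" "\<bar>s' - m\<bar> < \<eta>" "\<phi> s = \<phi> s'" for s s'
  proof -
    have dom: "x \<noteq> m" "\<bar>x - m\<bar> < \<eta>" if "s \<le> x" "x \<le> s'" for x
      using \<open>s < s'\<close> \<open>m < s \<or> s' < m\<close> \<open>\<bar>s - m\<bar> < \<eta>\<close> \<open>\<bar>s' - m\<bar> < \<eta>\<close> that by auto
    have "\<exists>z. s < z \<and> z < s' \<and> (\<phi> has_real_derivative 0) (at z)"
    proof (rule Rolle[OF \<open>s < s'\<close> \<open>\<phi> s = \<phi> s'\<close>])
      show "continuous_on {s..s'} \<phi>"
        by (rule DERIV_continuous_on) (use d\<phi> dom in \<open>auto intro: has_field_derivative_at_within\<close>)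
    qed (use d\<phi> dom in \<open>meson less_imp_le real_differentiable_def\<close>)
    then obtain z where z: "s < z" "z < s'" "(\<phi> has_real_derivative 0) (at z)" by blast
    then have "\<psi> z / g z = 0"
      using DERIV_unique d\<phi> dom[of z] by (metis less_imp_le)
    then show False using \<psi>nz gnz dom[of z] z by auto
  qed
  define c where "c = L / 2 / (2 * K) powr e"
  define C where "C = 2 * L / (K / 2) powr e"
  show ?thesis
  proof
    show "\<eta> > 0" by fact
    show "c > 0" "C > 0" using KL by (auto simp: c_def C_def)
    fix s t
    assume s: "0 < \<bar>s - m\<bar>" "\<bar>s - m\<bar> < \<eta>" "f s = t * g s"
    then have "s \<noteq> m" by auto
    define x where "x = \<bar>s - m\<bar>"
    have "x > 0" using s by (simp add: x_def)
    have \<phi>s: "\<phi> s = t" using \<phi>eq \<open>s \<noteq> m\<close> s by blast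
    have Hs: "K / 2 * x ^ (j - i) \<le> \<bar>t\<bar>" "\<bar>t\<bar> \<le> 2 * K * x ^ (j - i)"
         "L / 2 * x ^ (j - 1) \<le> \<bar>\<psi> s\<bar>" "\<bar>\<psi> s\<bar> \<le> 2 * L * x ^ (j - 1)"
      using H[OF \<open>s \<noteq> m\<close> s(2)] \<open>x > 0\<close>
      by (simp_all add: \<phi>s abs_divide power_abs field_simps flip: x_def)
    have xe: "(x ^ (j - i)) powr e = x ^ (j - 1)"
    proof -
      have "(x ^ (j - i)) powr e = (x powr real (j - i)) powr e"
        using \<open>x > 0\<close> by (simp add: powr_realpow)
      also have "\<dots> = x powr real (j - 1)"
        using \<open>i < j\<close> \<open>1 \<le> j\<close> by (simp add: powr_powr e_def of_nat_diff)
      finally show ?thesis using \<open>x > 0\<close> by (simp add: powr_realpow)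
    qed
    have "(K / 2 * x ^ (j - i)) powr e \<le> \<bar>t\<bar> powr e" "\<bar>t\<bar> powr e \<le> (2 * K * x ^ (j - i)) powr e"
      using Hs KL \<open>x > 0\<close> e by (auto intro!: powr_mono2)
    then have t: "(K / 2) powr e * x ^ (j - 1) \<le> \<bar>t\<bar> powr e" "\<bar>t\<bar> powr e \<le> (2 * K) powr e * x ^ (j - 1)"
      using KL \<open>x > 0\<close> powr_mult[of "K / 2" "x ^ (j - i)" e] powr_mult[of "2 * K" "x ^ (j - i)" e]
      by (simp_all only: xe)
    have "c * \<bar>t\<bar> powr e \<le> c * ((2 * K) powr e * x ^ (j - 1))"
      using t(2) \<open>c > 0\<close> by (intro mult_left_mono) auto
    also have "\<dots> = L / 2 * x ^ (j - 1)" using KL by (simp add: c_def)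
    finally have 1: "c * \<bar>t\<bar> powr e \<le> \<bar>\<psi> s\<bar>" using Hs by linarith
    have "2 * L * x ^ (j - 1) = C * ((K / 2) powr e * x ^ (j - 1))" using KL by (simp add: C_def)
    also have "\<dots> \<le> C * \<bar>t\<bar> powr e"
      using t(1) \<open>C > 0\<close> by (intro mult_left_mono) auto
    finally have 2: "\<bar>\<psi> s\<bar> \<le> C * \<bar>t\<bar> powr e" using Hs by linarith
    have "A / B * (t / (s - m) ^ (j - i)) > 0" using H[OF \<open>s \<noteq> m\<close> s(2)] \<phi>s by simp
    then have "A * B * t * (s - m) ^ (j - i) > 0"
      by (auto simp: zero_less_mult_iff zero_less_divide_iff mult_less_0_iff divide_less_0_iff)
    with 1 2 show "c * \<bar>t\<bar> powr e \<le> \<bar>f1 s - t * g1 s\<bar> \<and> \<bar>f1 s - t * g1 s\<bar> \<le> C * \<bar>t\<bar> powr e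
           \<and> A * B * t * (s - m) ^ (j - i) > 0"
      by (simp add: \<psi>_def \<phi>s)
  next
    fix s s' t
    assume "m < s \<and> m < s' \<or> s < m \<and> s' < m" "\<bar>s - m\<bar> < \<eta>" "\<bar>s' - m\<bar> < \<eta>"
      "f s = t * g s" "f s' = t * g s'"
    then show "s = s'"
      using inj[of s s'] inj[of s' s] \<phi>eq[of s t] \<phi>eq[of s' t] by (cases s s' rule: linorder_cases) auto
  qed
qed

lemma convex_double_zero_pos:
  fixes h :: "real \<Rightarrow> real"
  assumes d1: "\<And>x. x \<in> {l..k} \<Longrightarrow> (h has_real_derivative h' x) (at x)"
    and d2: "\<And>x. x \<in> {l..k} \<Longrightarrow> (h' has_real_derivative h'' x) (at x)"
    and pos: "\<And>x. x \<in> {l..k} \<Longrightarrow> h'' x > 0"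
    and v: "v \<in> {l..k}" "h v = 0" "h' v = 0" and u: "u \<in> {l..k}" "u \<noteq> v"
  shows "h u > 0"
proof (cases "v < u")
  case True
  obtain z where z: "v < z" "z < u" "h u - h v = (u - v) * h' z"
    using MVT2[OF True, of h h'] d1 u v by auto
  obtain y where y: "v < y" "y < z" "h' z - h' v = (z - v) * h'' y"
    using MVT2[OF z(1), of h' h''] d2 u v z by auto
  have "h'' y > 0" using pos y z u v by auto
  with y v have "h' z > 0" by simp
  with z v True show ?thesis by simp
next
  case False
  with u have uv: "u < v" by simp
  obtain z where z: "u < z" "z < v" "h v - h u = (v - u) * h' z"
    using MVT2[OF uv, of h h'] d1 u v by auto
  obtain y where y: "z < y" "y < v" "h' v - h' z = (v - z) * h'' y"
    using MVT2[OF z(2), of h' h''] d2 u v z by auto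
  have "h'' y > 0" using pos y z u v by auto
  with y have "(v - z) * h'' y > 0" by simp
  with y v have "h' z < 0" by simp
  then have "(v - u) * h' z < 0" using uv by (simp add: mult_pos_neg)
  with z v show ?thesis by simp
qed

section \<open>Regular arcs, equilibria and centres of curvature\<close>

text \<open>
  The components of u and w along v and along its quarter turn recover the inner product of u and w.
  For v = r' this expresses products with r'' through curvature and the slope of the distance.
\<close>

lemma inner_products_eq_frame:
  fixes u v w :: plane
  shows "(v \<bullet> v) * (u \<bullet> w) = (v \<bullet> u) * (v \<bullet> w) + det2 v u * det2 v w"
  by (simp add: inner_prod_def det2_def algebra_simps)

text \<open>
  Three vectors of the plane satisfy the linear relation with their pairwise determinants as
  coefficients; this is its inner product with the first vector.
\<close>

lemma inner_det2_cyclic: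
  fixes u v w :: plane
  shows "(u \<bullet> u) * det2 v w - (u \<bullet> v) * det2 u w + (u \<bullet> w) * det2 u v = 0"
  by (simp add: inner_prod_def det2_def algebra_simps)

lemma inner_rot90 [simp]: "rot90 v \<bullet> w = det2 v w" "w \<bullet> rot90 v = det2 v w"
  by (simp_all add: inner_prod_def det2_def rot90_def)

lemma det2_rot90 [simp]: "det2 v (rot90 w) = v \<bullet> w"
  by (simp add: inner_prod_def det2_def rot90_def)

lemma det2_self [simp]: "det2 v v = 0"
  by (simp add: det2_def)

lemma det2_right_simps:
  "det2 v (w + w') = det2 v w + det2 v w'" "det2 v (w - w') = det2 v w - det2 v w'"
  "det2 v (c *\<^sub>R w) = c * det2 v w" "det2 v 0 = 0"
  by (simp_all add: det2_def algebra_simps)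

lemma norm_rot90 [simp]: "norm (rot90 v) = norm v"
  by (simp add: rot90_def norm_prod_def add.commute)

lemma has_real_derivative_inner:
  fixes u v :: "real \<Rightarrow> 'a::real_inner"
  assumes "(u has_vector_derivative u') (at s within S)" "(v has_vector_derivative v') (at s within S)"
  shows "((\<lambda>s. u s \<bullet> v s) has_real_derivative u s \<bullet> v' + u' \<bullet> v s) (at s within S)"
  using bounded_bilinear.has_vector_derivative[OF bounded_bilinear_inner assms]
  by (simp add: has_real_derivative_iff_has_vector_derivative)

lemma has_real_derivative_det2:
  assumes "(u has_vector_derivative u') (at s within S)" "(v has_vector_derivative v') (at s within S)"
  shows "((\<lambda>s. det2 (u s) (v s)) has_real_derivative det2 (u s) v' + det2 u' (v s)) (at s within S)"
proof -
  have "((\<lambda>s. fst (u s)) has_real_derivative fst u') (at s within S)"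
       "((\<lambda>s. snd (u s)) has_real_derivative snd u') (at s within S)"
       "((\<lambda>s. fst (v s)) has_real_derivative fst v') (at s within S)"
       "((\<lambda>s. snd (v s)) has_real_derivative snd v') (at s within S)"
    using assms
    by (auto simp: has_real_derivative_iff_has_vector_derivative
        intro: bounded_linear.has_vector_derivative[OF bounded_linear_fst]
          bounded_linear.has_vector_derivative[OF bounded_linear_snd])
  then show ?thesis
    unfolding det2_def by (auto intro!: derivative_eq_intros simp: algebra_simps)
qed

text \<open>
  The derivatives are named so that all identities below become algebra in their values.
\<close>

locale regular_arc =
  fixes r r1 r2 r3 r4 :: "real \<Rightarrow> plane" and a b :: real
  assumes ab: "a < b"
    and derivs:
      "\<And>s. s \<in> {a..b} \<Longrightarrow> (r has_vector_derivative r1 s) (at s within {a..b})"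
      "\<And>s. s \<in> {a..b} \<Longrightarrow> (r1 has_vector_derivative r2 s) (at s within {a..b})"
      "\<And>s. s \<in> {a..b} \<Longrightarrow> (r2 has_vector_derivative r3 s) (at s within {a..b})"
      "\<And>s. s \<in> {a..b} \<Longrightarrow> (r3 has_vector_derivative r4 s) (at s within {a..b})"
    and regular: "\<And>s. s \<in> {a..b} \<Longrightarrow> r1 s \<noteq> 0"
begin

abbreviation "I \<equiv> {a..b}"

text \<open>
  Half the derivative of the squared distance to q along the curve, and its derivatives in the
  parameter. Unlike the derivative of the distance, the slope is defined at q itself and is affine
  in q.
\<close>

definition slope :: "real \<Rightarrow> plane \<Rightarrow> real" where
  "slope s q = (r s - q) \<bullet> r1 s"

definition slope1 :: "real \<Rightarrow> plane \<Rightarrow> real" where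
  "slope1 s q = r1 s \<bullet> r1 s + (r s - q) \<bullet> r2 s"

definition slope2 :: "real \<Rightarrow> plane \<Rightarrow> real" where
  "slope2 s q = 3 * (r1 s \<bullet> r2 s) + (r s - q) \<bullet> r3 s"

definition slope3 :: "real \<Rightarrow> plane \<Rightarrow> real" where
  "slope3 s q = 3 * (r2 s \<bullet> r2 s) + 4 * (r1 s \<bullet> r3 s) + (r s - q) \<bullet> r4 s"

lemma slope_affine:
  "slope s (q + d) = slope s q - d \<bullet> r1 s"
  "slope2 s (q + d) = slope2 s q - d \<bullet> r3 s"
  by (simp_all add: slope_def slope2_def algebra_simps)

lemma slope_line:
  "slope s (t *\<^sub>R w) = slope s 0 - t * (w \<bullet> r1 s)"
  "slope1 s (t *\<^sub>R w) = slope1 s 0 - t * (w \<bullet> r2 s)"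
  by (simp_all add: slope_def slope1_def algebra_simps)

lemma slope_derivs:
  assumes "s \<in> I"
  shows "((\<lambda>s. slope s q) has_real_derivative slope1 s q) (at s within I)"
    and "((\<lambda>s. slope1 s q) has_real_derivative slope2 s q) (at s within I)"
    and "((\<lambda>s. slope2 s q) has_real_derivative slope3 s q) (at s within I)"
proof -
  have d: "((\<lambda>s. r s - q) has_vector_derivative r1 s) (at s within I)"
    using derivs(1)[OF assms] by (auto intro!: derivative_eq_intros)
  note D = derivs[OF assms]
  show "((\<lambda>s. slope s q) has_real_derivative slope1 s q) (at s within I)"
    unfolding slope_def slope1_def
    by (rule DERIV_cong[OF has_real_derivative_inner[OF d D(2)]]) (simp add: inner_commute)
  show "((\<lambda>s. slope1 s q) has_real_derivative slope2 s q) (at s within I)"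
    unfolding slope1_def slope2_def
    by (rule DERIV_cong[OF DERIV_add[OF has_real_derivative_inner[OF D(2) D(2)]
        has_real_derivative_inner[OF d D(3)]]]) (simp add: inner_commute)
  show "((\<lambda>s. slope2 s q) has_real_derivative slope3 s q) (at s within I)"
    unfolding slope2_def slope3_def
    by (rule DERIV_cong[OF DERIV_add[OF DERIV_cmult[OF has_real_derivative_inner[OF D(2) D(3)]]
        has_real_derivative_inner[OF d D(4)]]]) (simp add: inner_commute)
qed

lemma at_interior: "s \<in> {a<..<b} \<Longrightarrow> at s within I = at s"
  by (rule at_within_interior) simp

lemma slope_derivs_at:
  assumes "s \<in> {a<..<b}"
  shows "((\<lambda>s. slope s q) has_real_derivative slope1 s q) (at s)"
    and "((\<lambda>s. slope1 s q) has_real_derivative slope2 s q) (at s)"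
    and "((\<lambda>s. slope2 s q) has_real_derivative slope3 s q) (at s)"
  using slope_derivs[of s q] assms at_interior[OF assms] by auto

lemma continuous_derivs:
  "continuous_on I r" "continuous_on I r1" "continuous_on I r2" "continuous_on I r3"
  by (rule continuous_on_vector_derivative, erule derivs)+

lemma continuous_slopes: "continuous_on I (\<lambda>s. slope s q)" "continuous_on I (\<lambda>s. slope2 s q)"
  unfolding slope_def slope2_def by (intro continuous_intros continuous_derivs)+

lemma velocity_eq: "s \<in> I \<Longrightarrow> velocity r I s = r1 s"
  unfolding velocity_def
  using vector_derivative_within_cbox[OF ab, where f = r and x = s] derivs(1)[of s] by simp

lemma acceleration_eq: "s \<in> I \<Longrightarrow> acceleration r I s = r2 s"
proof -
  assume s: "s \<in> I"
  have "(velocity r I has_vector_derivative r2 s) (at s within I)"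
    by (rule has_vector_derivative_transform[OF s _ derivs(2)[OF s]]) (simp add: velocity_eq)
  then show ?thesis
    unfolding acceleration_def
    using vector_derivative_within_cbox[OF ab, where f = "velocity r I" and x = s] s by simp
qed

lemma curvature_eq: "s \<in> I \<Longrightarrow> curvature r I s = det2 (r1 s) (r2 s) / norm (r1 s) ^ 3"
  by (simp add: curvature_def velocity_eq acceleration_eq)

lemma unit_normal_eq: "s \<in> I \<Longrightarrow> unit_normal r I s = rot90 (r1 s) /\<^sub>R norm (r1 s)"
  by (simp add: unit_normal_def velocity_eq)

lemma equilibria_eq: "equilibria r I q = {s \<in> I. slope s q = 0}"
proof -
  have "(r s = q \<or> ((\<lambda>u. norm (r u - q)) has_real_derivative 0) (at s within I)) \<longleftrightarrow> slope s q = 0"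
    if s: "s \<in> I" for s
  proof (cases "r s = q")
    case True
    then show ?thesis by (simp add: slope_def)
  next
    case False
    have "((\<lambda>u. r u - q) has_derivative (\<lambda>h. h *\<^sub>R r1 s)) (at s within I)"
      using derivs(1)[OF s] by (auto intro!: derivative_eq_intros simp: has_vector_derivative_def)
    from has_derivative_compose[OF this has_derivative_norm] False
    have "((\<lambda>u. norm (r u - q)) has_derivative (\<lambda>h. (h *\<^sub>R r1 s) \<bullet> sgn (r s - q))) (at s within I)"
      by simp
    then have D: "((\<lambda>u. norm (r u - q)) has_real_derivative slope s q / norm (r s - q)) (at s within I)"
      by (auto simp: has_field_derivative_def slope_def sgn_div_norm inner_commute divide_inverse mult_ac
          elim!: has_derivative_eq_rhs)
    have "((\<lambda>u. norm (r u - q)) has_real_derivative 0) (at s within I) \<longleftrightarrow> slope s q / norm (r s - q) = 0"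
    proof
      assume "((\<lambda>u. norm (r u - q)) has_real_derivative 0) (at s within I)"
      with D show "slope s q / norm (r s - q) = 0"
        using vector_derivative_within_cbox[OF ab, where f = "\<lambda>u. norm (r u - q)" and x = s] s
        unfolding has_real_derivative_iff_has_vector_derivative by (metis box_real(2))
    next
      assume "slope s q / norm (r s - q) = 0"
      with D show "((\<lambda>u. norm (r u - q)) has_real_derivative 0) (at s within I)" by simp
    qed
    with False show ?thesis by simp
  qed
  then show ?thesis by (auto simp: equilibria_def)
qed

text \<open>
  At an equilibrium, r - q is normal to the curve, so only the normal part of r'' contributes to
  (r - q) \<bullet> r''. Hence the denominator of both indices is the derivative of the slope, up to
  the positive factor |r'|^2.
\<close>

lemma index_denominator:
  assumes s: "s \<in> I" and "slope s q = 0"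
  shows "1 + kappa_rho r I q s = slope1 s q / (r1 s \<bullet> r1 s)"
proof -
  let ?v = "r1 s" and ?d = "r s - q"
  have v: "?v \<noteq> 0" "norm ?v \<noteq> 0" using regular[OF s] by auto
  have n2: "norm ?v * norm ?v = ?v \<bullet> ?v" by (simp add: power2_eq_square[symmetric] power2_norm_eq_inner)
  have "kappa_rho r I q s = curvature r I s * (unit_normal r I s \<bullet> ?d)"
    by (cases "r s = q") (simp_all add: kappa_rho_def curvature_wrt_def)
  also have "\<dots> = det2 ?v (r2 s) * det2 ?v ?d / ((?v \<bullet> ?v) * (?v \<bullet> ?v))"
    using v by (simp add: curvature_eq[OF s] unit_normal_eq[OF s] power3_eq_cube n2[symmetric] field_simps)
  also have "det2 ?v (r2 s) * det2 ?v ?d = (?v \<bullet> ?v) * (?d \<bullet> r2 s)"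
    using assms(2) inner_products_eq_frame[of ?v ?d "r2 s"] by (simp add: slope_def inner_commute)
  finally have "kappa_rho r I q s = (?d \<bullet> r2 s) / (?v \<bullet> ?v)"
    using v by simp
  then show ?thesis
    using v by (simp add: slope1_def field_simps)
qed

text \<open>
  A point with zero slope and zero slope derivative at s is the solution of a 2-by-2 linear system
  with determinant det2 r' r''; it is the centre of curvature, and the formula is Cramer's rule.
  Through it the evolute near m can be studied without differentiating the curvature.
\<close>

lemma curvature_center_eq:
  assumes s: "s \<in> I" and "curvature r I s \<noteq> 0"
  shows "curvature_center r I s =
           (slope1 s 0 / det2 (r1 s) (r2 s)) *\<^sub>R rot90 (r1 s) - (slope s 0 / det2 (r1 s) (r2 s)) *\<^sub>R rot90 (r2 s)"
    and "slope s (curvature_center r I s) = 0" "slope1 s (curvature_center r I s) = 0"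
proof -
  let ?D = "det2 (r1 s) (r2 s)" and ?c = "curvature_center r I s"
  have v: "r1 s \<noteq> 0" "norm (r1 s) \<noteq> 0" using regular[OF s] by auto
  have D: "?D \<noteq> 0" using assms by (auto simp: curvature_eq)
  have n2: "norm (r1 s) * norm (r1 s) = r1 s \<bullet> r1 s" by (simp add: power2_eq_square[symmetric] power2_norm_eq_inner)
  have c: "?c = r s + (r1 s \<bullet> r1 s / ?D) *\<^sub>R rot90 (r1 s)"
    using v D by (simp add: curvature_center_def curvature_eq[OF s] unit_normal_eq[OF s] power3_eq_cube n2[symmetric] field_simps)
  show "slope s ?c = 0" "slope1 s ?c = 0"
    using D by (simp_all add: slope_def slope1_def c inner_add_left inner_diff_left)
  have "?D *\<^sub>R r s + (r1 s \<bullet> r1 s) *\<^sub>R rot90 (r1 s) = slope1 s 0 *\<^sub>R rot90 (r1 s) - slope s 0 *\<^sub>R rot90 (r2 s)"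
    by (rule prod_eqI) (simp_all add: slope_def slope1_def rot90_def det2_def inner_prod_def algebra_simps)
  then have "(1 / ?D) *\<^sub>R (?D *\<^sub>R r s + (r1 s \<bullet> r1 s) *\<^sub>R rot90 (r1 s)) = (1 / ?D) *\<^sub>R (slope1 s 0 *\<^sub>R rot90 (r1 s) - slope s 0 *\<^sub>R rot90 (r2 s))"
    by simp
  then show "?c = (slope1 s 0 / ?D) *\<^sub>R rot90 (r1 s) - (slope s 0 / ?D) *\<^sub>R rot90 (r2 s)"
    using D by (simp add: c scaleR_add_right scaleR_diff_right)
qed

end

section \<open>A degenerate equilibrium and the derivatives of the curvature\<close>

locale degenerate_arc = regular_arc +
  fixes m :: real
  assumes m: "a < m" "m < b"
    and unique: "equilibria r {a..b} 0 = {m}"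
    and degenerate: "degenerate r {a..b} 0 m"
begin

lemma mI [simp]: "m \<in> I" "m \<in> {a<..<b}" "a \<le> m" "m \<le> b" "a < m" "m < b" using m by auto

lemma slope_m [simp]: "slope m 0 = 0" and slope_nz: "s \<in> I \<Longrightarrow> s \<noteq> m \<Longrightarrow> slope s 0 \<noteq> 0"
  using unique by (auto simp: equilibria_eq)

lemma r1_m: "r1 m \<noteq> 0" "r1 m \<bullet> r1 m > 0"
  using regular[of m] by auto

lemma slope1_m [simp]: "slope1 m 0 = 0"
  using degenerate index_denominator[of m 0] r1_m by (simp add: degenerate_def)

lemma near_m: "\<forall>\<^sub>F s in nhds m. s \<in> {a<..<b}"
  using eventually_nhds_in_open[of "{a<..<b}" m] by simp

text \<open>
  This is degeneracy in vector form: the origin is the centre of curvature.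
\<close>

lemma position_m: "det2 (r1 m) (r2 m) *\<^sub>R r m = - (r1 m \<bullet> r1 m) *\<^sub>R rot90 (r1 m)"
proof -
  have "det2 (r1 m) (r2 m) *\<^sub>R r m = (slope1 m 0 - r1 m \<bullet> r1 m) *\<^sub>R rot90 (r1 m) - slope m 0 *\<^sub>R rot90 (r2 m)"
    by (rule prod_eqI) (simp_all add: slope_def slope1_def rot90_def det2_def inner_prod_def algebra_simps)
  then show ?thesis by simp
qed

lemma det_m: "det2 (r1 m) (r2 m) \<noteq> 0"
  using position_m r1_m by (metis inner_zero_left neg_equal_0_iff_equal norm_eq_zero norm_rot90 order_less_irrefl scaleR_eq_0_iff)

lemma center_m: "curvature_center r I m = 0"
  using curvature_center_eq(1)[of m] det_m r1_m by (simp add: curvature_eq)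

text \<open>
  The derivative of the curvature, cleared of the denominator |r'|^5.
\<close>

definition curvature_numerator :: "real \<Rightarrow> real" where
  "curvature_numerator s = det2 (r1 s) (r3 s) * (r1 s \<bullet> r1 s) - 3 * det2 (r1 s) (r2 s) * (r1 s \<bullet> r2 s)"

lemma curvature_deriv:
  assumes s: "s \<in> {a<..<b}"
  shows "(curvature r I has_real_derivative curvature_numerator s / norm (r1 s) ^ 5) (at s)"
proof -
  have sI: "s \<in> I" using s by auto
  have v: "r1 s \<noteq> 0" "norm (r1 s) > 0" using regular[OF sI] by auto
  note D = derivs[OF sI, unfolded at_interior[OF s]]
  have n2: "norm (r1 s) * norm (r1 s) = r1 s \<bullet> r1 s" by (simp add: power2_eq_square[symmetric] power2_norm_eq_inner)
  have "(norm has_derivative (\<lambda>h. h \<bullet> sgn (r1 s))) (at (r1 s))"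
    using has_derivative_norm[OF v(1)] by simp
  from has_derivative_compose[OF D(2)[unfolded has_vector_derivative_def] this]
  have dn: "((\<lambda>s. norm (r1 s)) has_real_derivative (r1 s \<bullet> r2 s) / norm (r1 s)) (at s)"
    by (auto simp: has_field_derivative_def sgn_div_norm inner_commute field_simps elim!: has_derivative_eq_rhs)
  have "((\<lambda>s. det2 (r1 s) (r2 s)) has_real_derivative det2 (r1 s) (r3 s)) (at s)"
    using has_real_derivative_det2[OF D(2,3)] by simp
  then have "((\<lambda>s. det2 (r1 s) (r2 s) / norm (r1 s) ^ 3) has_real_derivative curvature_numerator s / norm (r1 s) ^ 5) (at s)"
    using v dn unfolding curvature_numerator_def n2[symmetric]
    by (auto intro!: derivative_eq_intros simp: field_simps power2_eq_square eval_nat_numeral)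
  then show ?thesis
  proof (rule has_field_derivative_transform_within_open[of _ _ _ "{a<..<b}"])
  qed (use s in \<open>auto simp: curvature_eq\<close>)
qed

text \<open>
  At m the position vector is a multiple of the quarter turn of r', so a product of the form
  r \<bullet> v becomes a determinant det2 r' v. After this substitution the first two derivatives of the
  curvature become multiples of the second and third derivatives of the slope, here and in the next
  lemma.
\<close>

lemma curvature_numerator_m: "curvature_numerator m = - det2 (r1 m) (r2 m) * slope2 m 0"
proof -
  have "det2 (r1 m) (r2 m) * (r m \<bullet> r3 m) = (det2 (r1 m) (r2 m) *\<^sub>R r m) \<bullet> r3 m" by simp
  also have "\<dots> = - (r1 m \<bullet> r1 m) * det2 (r1 m) (r3 m)" by (simp only: position_m) simp
  finally show ?thesis by (simp add: curvature_numerator_def slope2_def algebra_simps)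
qed

lemma curvature_numerator_deriv_m: "(curvature_numerator has_real_derivative - det2 (r1 m) (r2 m) * slope3 m 0) (at m)"
proof -
  note D = derivs[OF mI(1), unfolded at_interior[OF mI(2)]]
  have d13: "((\<lambda>s. det2 (r1 s) (r3 s)) has_real_derivative det2 (r1 m) (r4 m) + det2 (r2 m) (r3 m)) (at m)"
    by (rule has_real_derivative_det2[OF D(2,4)])
  have d12: "((\<lambda>s. det2 (r1 s) (r2 s)) has_real_derivative det2 (r1 m) (r3 m)) (at m)"
    using has_real_derivative_det2[OF D(2,3)] by simp
  have i11: "((\<lambda>s. r1 s \<bullet> r1 s) has_real_derivative 2 * (r1 m \<bullet> r2 m)) (at m)"
    using has_real_derivative_inner[OF D(2,2)] by (simp add: inner_commute)
  have i12: "((\<lambda>s. r1 s \<bullet> r2 s) has_real_derivative r1 m \<bullet> r3 m + r2 m \<bullet> r2 m) (at m)"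
    by (rule has_real_derivative_inner[OF D(2,3)])
  have "det2 (r1 m) (r2 m) * (r m \<bullet> r4 m) = (det2 (r1 m) (r2 m) *\<^sub>R r m) \<bullet> r4 m" by simp
  also have "\<dots> = - (r1 m \<bullet> r1 m) * det2 (r1 m) (r4 m)" by (simp only: position_m) simp
  finally have e: "det2 (r1 m) (r2 m) * (r m \<bullet> r4 m) = - (r1 m \<bullet> r1 m) * det2 (r1 m) (r4 m)" .
  have "(curvature_numerator has_real_derivative
     (det2 (r1 m) (r4 m) + det2 (r2 m) (r3 m)) * (r1 m \<bullet> r1 m) + 2 * (r1 m \<bullet> r2 m) * det2 (r1 m) (r3 m)
     - (3 * det2 (r1 m) (r3 m) * (r1 m \<bullet> r2 m) + (r1 m \<bullet> r3 m + r2 m \<bullet> r2 m) * (3 * det2 (r1 m) (r2 m)))) (at m)"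
    unfolding curvature_numerator_def
    by (rule DERIV_diff[OF DERIV_mult[OF d13 i11] DERIV_mult[OF DERIV_cmult[OF d12] i12]])
  then show ?thesis
    by (rule DERIV_cong) (use e inner_det2_cyclic[of "r1 m" "r2 m" "r3 m"] in \<open>simp add: slope3_def algebra_simps\<close>)
qed

lemma generic_point_slope2: "generic_evolute_point r I m \<Longrightarrow> slope2 m 0 \<noteq> 0"
  using DERIV_imp_deriv[OF curvature_deriv[of m]] by (auto simp: generic_evolute_point_def curvature_numerator_m)

lemma generic_cusp_slopes:
  assumes "generic_evolute_cusp r I m"
  shows "slope2 m 0 = 0" "slope3 m 0 \<noteq> 0"
proof -
  have d: "deriv (curvature r I) s = curvature_numerator s / norm (r1 s) ^ 5" if "s \<in> {a<..<b}" for s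
    using DERIV_imp_deriv[OF curvature_deriv[OF that]] .
  have *: "curvature_numerator m / norm (r1 m) ^ 5 = 0" "deriv (deriv (curvature r I)) m \<noteq> 0"
    using assms by (auto simp: generic_evolute_cusp_def d)
  then have num0: "curvature_numerator m = 0" using r1_m by simp
  then show "slope2 m 0 = 0" using det_m by (simp add: curvature_numerator_m)
  have "(r1 has_vector_derivative r2 m) (at m)"
    using derivs(2)[of m] at_interior[of m] by simp
  from has_derivative_compose[OF this[unfolded has_vector_derivative_def] has_derivative_norm[OF r1_m(1)]]
  have "((\<lambda>s. norm (r1 s)) has_real_derivative (r2 m \<bullet> sgn (r1 m))) (at m)"
    by (auto simp: has_field_derivative_def elim!: has_derivative_eq_rhs)
  then have "((\<lambda>s. norm (r1 s) ^ 5) has_real_derivative 5 * norm (r1 m) ^ 4 * (r2 m \<bullet> sgn (r1 m))) (at m)"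
    by (auto intro!: derivative_eq_intros)
  from DERIV_divide[OF curvature_numerator_deriv_m this]
  have "((\<lambda>s. curvature_numerator s / norm (r1 s) ^ 5) has_real_derivative
     - det2 (r1 m) (r2 m) * slope3 m 0 / norm (r1 m) ^ 5) (at m)"
  proof (rule DERIV_cong)
    have n: "norm (r1 m) ^ 5 \<noteq> 0" using r1_m by simp
    show "(- det2 (r1 m) (r2 m) * slope3 m 0 * norm (r1 m) ^ 5 -
      curvature_numerator m * (5 * norm (r1 m) ^ 4 * (r2 m \<bullet> sgn (r1 m)))) / (norm (r1 m) ^ 5 * norm (r1 m) ^ 5) =
      - det2 (r1 m) (r2 m) * slope3 m 0 / norm (r1 m) ^ 5"
      unfolding num0 by (simp only: mult_zero_left diff_0_right nonzero_mult_divide_mult_cancel_right[OF n])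
  qed (use r1_m in simp)
  then have "(deriv (curvature r I) has_real_derivative
     - det2 (r1 m) (r2 m) * slope3 m 0 / norm (r1 m) ^ 5) (at m)"
    by (rule has_field_derivative_transform_within_open[of _ _ _ "{a<..<b}"]) (use d in auto)
  from DERIV_imp_deriv[OF this] * show "slope3 m 0 \<noteq> 0" by auto
qed

section \<open>Orders of vanishing and the tangent of the evolute\<close>

lemma slope_derivs_near:
  "\<forall>\<^sub>F s in nhds m. ((\<lambda>s. slope s 0) has_real_derivative slope1 s 0) (at s)"
  "\<forall>\<^sub>F s in nhds m. ((\<lambda>s. slope1 s 0) has_real_derivative slope2 s 0) (at s)"
  by (rule eventually_mono[OF near_m], rule slope_derivs_at, assumption)+

lemma velocity_component_derivs:
  "s \<in> {a<..<b} \<Longrightarrow> ((\<lambda>s. w \<bullet> r1 s) has_real_derivative w \<bullet> r2 s) (at s)"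
  using has_real_derivative_inner[of "\<lambda>s. w" 0 s UNIV r1 "r2 s"] derivs(2)[of s] at_interior[of s] by auto

definition slope_order :: "nat \<Rightarrow> real \<Rightarrow> bool" where
  "slope_order j A \<longleftrightarrow> A \<noteq> 0 \<and> 2 \<le> j \<and>
     ((\<lambda>s. slope s 0 / (s - m) ^ j) \<longlongrightarrow> A) (at m) \<and>
     ((\<lambda>s. slope1 s 0 / (s - m) ^ (j - 1)) \<longlongrightarrow> real j * A) (at m)"

lemma order_two:
  assumes "slope2 m 0 \<noteq> 0"
  shows "slope_order 2 (slope2 m 0 / 2)"
proof -
  have 1: "((\<lambda>s. slope1 s 0 / (s - m) ^ 1) \<longlongrightarrow> slope2 m 0) (at m)"
    using derivative_quotient_limit[OF slope_derivs_at(2)[OF mI(2), of 0]] by simp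
  have "((\<lambda>s. slope s 0 / (s - m) ^ Suc 1) \<longlongrightarrow> slope2 m 0 / real (Suc 1)) (at m)"
    by (rule antiderivative_quotient_limit[OF slope_derivs_near(1) slope_m 1])
  with 1 assms show ?thesis by (simp add: slope_order_def numeral_2_eq_2)
qed

lemma order_three:
  assumes "slope2 m 0 = 0" "slope3 m 0 \<noteq> 0"
  shows "slope_order 3 (slope3 m 0 / 6)"
proof -
  have 2: "((\<lambda>s. slope2 s 0 / (s - m) ^ 1) \<longlongrightarrow> slope3 m 0) (at m)"
    using derivative_quotient_limit[OF slope_derivs_at(3)[OF mI(2), of 0]] assms by simp
  have 1: "((\<lambda>s. slope1 s 0 / (s - m) ^ Suc 1) \<longlongrightarrow> slope3 m 0 / real (Suc 1)) (at m)"
    by (rule antiderivative_quotient_limit[OF slope_derivs_near(2) slope1_m 2])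
  have "((\<lambda>s. slope s 0 / (s - m) ^ Suc (Suc 1)) \<longlongrightarrow> slope3 m 0 / real (Suc 1) / real (Suc (Suc 1))) (at m)"
    by (rule antiderivative_quotient_limit[OF slope_derivs_near(1) slope_m 1])
  with 1 assms show ?thesis by (simp add: slope_order_def numeral_3_eq_3)
qed

lemma frame_limits:
  "((\<lambda>s. det2 (r1 s) (r2 s)) \<longlongrightarrow> det2 (r1 m) (r2 m)) (at m)"
  "((\<lambda>s. rot90 (r1 s)) \<longlongrightarrow> rot90 (r1 m)) (at m)"
  "((\<lambda>s. rot90 (r2 s)) \<longlongrightarrow> rot90 (r2 m)) (at m)"
proof -
  have "isCont r1 m" "isCont r2 m"
    using derivs(2,3)[OF mI(1)] by (auto simp: at_interior intro: has_vector_derivative_continuous)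
  then have cont: "(r1 \<longlongrightarrow> r1 m) (at m)" "(r2 \<longlongrightarrow> r2 m) (at m)"
    by (simp_all add: isCont_def)
  show "((\<lambda>s. det2 (r1 s) (r2 s)) \<longlongrightarrow> det2 (r1 m) (r2 m)) (at m)"
    unfolding det2_def by (intro tendsto_intros cont)
  show "((\<lambda>s. rot90 (r1 s)) \<longlongrightarrow> rot90 (r1 m)) (at m)" "((\<lambda>s. rot90 (r2 s)) \<longlongrightarrow> rot90 (r2 m)) (at m)"
    unfolding rot90_def by (intro tendsto_intros cont)+
qed

lemma curvature_nz_near: "\<forall>\<^sub>F s in at m. s \<in> {a<..<b} \<and> curvature r I s \<noteq> 0"
proof -
  have "\<forall>\<^sub>F s in at m. det2 (r1 s) (r2 s) \<noteq> 0"
    by (rule tendsto_imp_eventually_ne[OF frame_limits(1) det_m])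
  moreover have "\<forall>\<^sub>F s in at m. s \<in> {a<..<b}"
    using near_m by (auto simp: eventually_at_filter elim: eventually_mono)
  ultimately show ?thesis
    by eventually_elim (use regular in \<open>auto simp: curvature_eq\<close>)
qed

text \<open>
  By Cramer's rule, the centre of curvature is (slope1 / det2 r' r'') times the quarter turn of r', up
  to terms of higher order. So after division by (s - m)^(j - 1) it has a nonzero limit normal to the
  curve, at regular points and at cusps of the evolute alike, and this limit is the tangent direction.
\<close>

lemma evolute_tangent_iff:
  assumes ord: "slope_order j A" and w: "w \<noteq> 0"
  shows "evolute_tangent r I m w \<longleftrightarrow> w \<bullet> r1 m = 0"
proof -
  let ?D = "\<lambda>s. det2 (r1 s) (r2 s)" and ?c = "curvature_center r I"
  define k where "k = j - 1"
  have k: "j = Suc k" using ord by (auto simp: k_def slope_order_def)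
  define L where "L = (real j * A / ?D m) *\<^sub>R rot90 (r1 m)"
  have ne: "\<forall>\<^sub>F s in at m. s \<noteq> m" by (simp add: eventually_at_filter)
  have l1: "((\<lambda>s. slope1 s 0 / (s - m) ^ k) \<longlongrightarrow> real j * A) (at m)"
    using ord by (simp add: slope_order_def k)
  have "((\<lambda>s. slope s 0 / (s - m) ^ j * (s - m)) \<longlongrightarrow> A * (m - m)) (at m)"
    by (intro tendsto_intros) (use ord in \<open>simp add: slope_order_def\<close>)
  then have l0: "((\<lambda>s. slope s 0 / (s - m) ^ k) \<longlongrightarrow> 0) (at m)"
    using Lim_transform_eventually[of _ "A * (m - m)" "at m" "\<lambda>s. slope s 0 / (s - m) ^ k"] ne
    by (auto elim!: eventually_mono simp: k)
  have "((\<lambda>s. (slope1 s 0 / (s - m) ^ k / ?D s) *\<^sub>R rot90 (r1 s) - (slope s 0 / (s - m) ^ k / ?D s) *\<^sub>R rot90 (r2 s))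
      \<longlongrightarrow> (real j * A / ?D m) *\<^sub>R rot90 (r1 m) - (0 / ?D m) *\<^sub>R rot90 (r2 m)) (at m)"
    by (intro tendsto_intros l1 l0 frame_limits det_m)
  moreover have "\<forall>\<^sub>F s in at m. (slope1 s 0 / (s - m) ^ k / ?D s) *\<^sub>R rot90 (r1 s) - (slope s 0 / (s - m) ^ k / ?D s) *\<^sub>R rot90 (r2 s)
     = (1 / (s - m) ^ k) *\<^sub>R ?c s"
    using curvature_nz_near
    by eventually_elim (simp add: curvature_center_eq(1) scaleR_diff_right mult.commute)
  ultimately have lc: "((\<lambda>s. (1 / (s - m) ^ k) *\<^sub>R ?c s) \<longlongrightarrow> L) (at m)"
    unfolding L_def by (simp add: Lim_transform_eventually)
  have "r1 m \<noteq> 0" by (rule r1_m)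
  have L: "L \<noteq> 0"
    using ord det_m \<open>r1 m \<noteq> 0\<close> by (auto simp: L_def slope_order_def rot90_def prod_eq_iff)
  define h where "h = (\<lambda>c. \<bar>det2 w c\<bar> / (norm w * norm c))"
  have "((\<lambda>s. h ((1 / (s - m) ^ k) *\<^sub>R ?c s)) \<longlongrightarrow> h L) (at m)"
    unfolding h_def det2_def by (intro tendsto_intros lc) (use L w in simp)
  moreover have "\<forall>\<^sub>F s in at m. h ((1 / (s - m) ^ k) *\<^sub>R ?c s) = h (?c s)"
    using ne by eventually_elim (simp add: h_def det2_right_simps abs_mult)
  ultimately have "((\<lambda>s. h (?c s)) \<longlongrightarrow> h L) (at m)"
    by (rule Lim_transform_eventually)
  then have "((\<lambda>s. h (?c s)) \<longlongrightarrow> 0) (at m) \<longleftrightarrow> h L = 0"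
    using tendsto_unique[OF trivial_limit_at] by metis
  also have "\<dots> \<longleftrightarrow> det2 w L = 0" using L w by (simp add: h_def)
  also have "\<dots> \<longleftrightarrow> w \<bullet> r1 m = 0"
    using ord det_m by (auto simp: L_def det2_right_simps slope_order_def)
  finally show ?thesis
    using w by (simp add: evolute_tangent_def center_m at_interior h_def)
qed

section \<open>From slopes at equilibria to the order of the index sum\<close>

text \<open>
  Away from m the slope with respect to the origin is bounded away from zero by compactness, because
  m is the only equilibrium. So zeros of the slope with respect to a point v near the origin,
  where slope s 0 = v \<bullet> r' s, are close to m. This applies to equilibria as well as to evolute
  points: a centre of curvature near the origin belongs to a parameter near m.
\<close>

lemma equilibria_localized:
  assumes "\<eta> > 0"
  obtains \<delta> where "\<delta> > 0" and "\<And>s v. s \<in> I \<Longrightarrow> norm v < \<delta> \<Longrightarrow> slope s 0 = v \<bullet> r1 s \<Longrightarrow> \<bar>s - m\<bar> < \<eta>"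
proof -
  define K where "K = I - {m - \<eta><..<m + \<eta>}"
  have "compact K" unfolding K_def by (rule compact_diff) auto
  have cK: "continuous_on K (\<lambda>s. \<bar>slope s 0\<bar> / norm (r1 s))"
    by (intro continuous_intros continuous_on_subset[OF continuous_slopes(1)] continuous_on_subset[OF continuous_derivs(2)])
      (use regular in \<open>auto simp: K_def\<close>)
  obtain \<delta> where \<delta>: "\<delta> > 0" "\<And>s. s \<in> K \<Longrightarrow> \<delta> \<le> \<bar>slope s 0\<bar> / norm (r1 s)"
  proof (cases "K = {}")
    case True
    then show ?thesis using that[of 1] by simp
  next
    case False
    obtain x where x: "x \<in> K" "\<And>s. s \<in> K \<Longrightarrow> \<bar>slope x 0\<bar> / norm (r1 x) \<le> \<bar>slope s 0\<bar> / norm (r1 s)"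
      using continuous_attains_inf[OF \<open>compact K\<close> False cK] by blast
    then have "\<bar>slope x 0\<bar> / norm (r1 x) > 0"
      using slope_nz[of x] regular[of x] \<open>\<eta> > 0\<close> by (auto simp: K_def)
    with x show ?thesis using that by blast
  qed
  show ?thesis
  proof
    fix s v assume s: "s \<in> I" "norm v < \<delta>" "slope s 0 = v \<bullet> r1 s"
    show "\<bar>s - m\<bar> < \<eta>"
    proof (rule ccontr)
      assume "\<not> \<bar>s - m\<bar> < \<eta>"
      then have "s \<in> K" using s by (auto simp: K_def)
      then have "\<delta> * norm (r1 s) \<le> \<bar>v \<bullet> r1 s\<bar>" using \<delta>(2)[of s] regular[of s] s by (simp add: field_simps)
      also have "\<dots> \<le> norm v * norm (r1 s)" by (rule Cauchy_Schwarz_ineq2)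
      also have "\<dots> < \<delta> * norm (r1 s)" using s regular[of s] by simp
      finally show False by simp
    qed
  qed fact
qed

text \<open>
  At an equilibrium put z = 1 + kappa_rho. Its contribution (1 + |z - 1|) / |z| lies between 1 / |z| and
  1 + 2 / |z|, and |z| is comparable to |slope1| because |r'|^2 is bounded above and away from zero.
  A bounded number of equilibria with slope1 of order |t|^e therefore gives the order of N0; for the
  lower bound one equilibrium is enough.
\<close>

lemma N0_Theta:
  fixes F :: "real filter" and e :: real
  assumes F: "F \<le> at 0" and e: "e \<ge> 0" and c: "c > 0"
    and roots: "\<forall>\<^sub>F t in F. \<exists>X. finite X \<and> card X \<le> n \<and>
       (\<forall>s\<in>I. slope s (t *\<^sub>R w) = 0 \<longrightarrow> s \<in> X \<and> c * \<bar>t\<bar> powr e \<le> \<bar>slope1 s (t *\<^sub>R w)\<bar>)"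
    and ex: "\<forall>\<^sub>F t in F. \<exists>s\<in>I. slope s (t *\<^sub>R w) = 0 \<and> \<bar>slope1 s (t *\<^sub>R w)\<bar> \<le> C * \<bar>t\<bar> powr e"
  shows "is_Theta F (\<lambda>t. N0 r I (t *\<^sub>R w)) (\<lambda>t. 1 / \<bar>t\<bar> powr e)"
proof -
  have "continuous_on I (\<lambda>s. r1 s \<bullet> r1 s)" by (intro continuous_intros continuous_derivs)
  moreover have "I \<noteq> {}" using mI by blast
  ultimately obtain s1 s2 where s12: "s1 \<in> I" "s2 \<in> I" "\<And>s. s \<in> I \<Longrightarrow> r1 s1 \<bullet> r1 s1 \<le> r1 s \<bullet> r1 s" "\<And>s. s \<in> I \<Longrightarrow> r1 s \<bullet> r1 s \<le> r1 s2 \<bullet> r1 s2"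
    using continuous_attains_inf[of I "\<lambda>s. r1 s \<bullet> r1 s"] continuous_attains_sup[of I "\<lambda>s. r1 s \<bullet> r1 s"] by blast
  define l where "l = r1 s1 \<bullet> r1 s1"
  define u where "u = r1 s2 \<bullet> r1 s2"
  have lu: "0 < l" "0 < u" using s12(1,2) regular by (auto simp: l_def u_def)
  have v: "l \<le> r1 s \<bullet> r1 s" "r1 s \<bullet> r1 s \<le> u" if "s \<in> I" for s using s12 that by (auto simp: l_def u_def)
  \<comment> \<open>The maximum makes the constant positive whatever the sign of \<open>C\<close>.\<close>
  define C' where "C' = max C 1"
  have C': "C' > 0" by (simp add: C'_def)
  define C2 where "C2 = real (Suc n) * (1 + 2 * u / c)"
  define C1 where "C1 = l / C'"
  have C2: "C2 > 0" using lu c by (auto simp: C2_def intro!: mult_pos_pos add_pos_nonneg)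
  have small: "\<forall>\<^sub>F t in F. t \<noteq> 0 \<and> \<bar>t\<bar> \<le> 1"
  proof (rule filter_leD[OF F])
    show "\<forall>\<^sub>F t in at 0. t \<noteq> (0::real) \<and> \<bar>t\<bar> \<le> 1"
      by (rule eventually_at_topological[THEN iffD2], rule exI[of _ "ball 0 1"]) (auto simp: dist_real_def)
  qed
  have w: "S0 r I (t *\<^sub>R w) s + U0 r I (t *\<^sub>R w) s \<le> ennreal ((1 + 2 * u / c) / \<bar>t\<bar> powr e)"
    if t: "t \<noteq> 0" "\<bar>t\<bar> \<le> 1" and s: "s \<in> I" "slope s (t *\<^sub>R w) = 0" "c * \<bar>t\<bar> powr e \<le> \<bar>slope1 s (t *\<^sub>R w)\<bar>" for s t
  proof -
    define z where "z = slope1 s (t *\<^sub>R w) / (r1 s \<bullet> r1 s)"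
    define T where "T = \<bar>t\<bar> powr e"
    have T: "0 < T" "T \<le> 1" using t e by (auto simp: T_def intro: powr_le1)
    have z: "1 + kappa_rho r I (t *\<^sub>R w) s = z" "kappa_rho r I (t *\<^sub>R w) s = z - 1"
      using index_denominator[OF s(1,2)] by (auto simp: z_def)
    have "c * T / u \<le> c * T / (r1 s \<bullet> r1 s)"
      using v[OF s(1)] lu c T by (intro divide_left_mono) (auto intro!: mult_pos_pos)
    also have "\<dots> \<le> \<bar>z\<bar>"
      using s(3) v[OF s(1)] lu by (auto simp: z_def T_def abs_divide intro!: divide_right_mono)
    finally have zl: "c * T / u \<le> \<bar>z\<bar>" .
    have "0 < c * T / u" using c T lu by simp
    then have zp: "\<bar>z\<bar> > 0" using zl by linarith
    have "S0 r I (t *\<^sub>R w) s + U0 r I (t *\<^sub>R w) s = ennreal ((1 + \<bar>z - 1\<bar>) / \<bar>z\<bar>)"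
      using zp by (simp add: S0_def U0_def z divide_ennreal add_divide_distrib flip: ennreal_1 ennreal_plus)
    also have "\<dots> \<le> ennreal ((1 + 2 * u / c) / T)"
    proof (rule ennreal_leI)
      have "(1 + \<bar>z - 1\<bar>) / \<bar>z\<bar> \<le> (2 + \<bar>z\<bar>) / \<bar>z\<bar>" using zp by (intro divide_right_mono) auto
      also have "\<dots> = 1 + 2 / \<bar>z\<bar>" using zp by (simp add: field_simps)
      also have "\<dots> \<le> 1 / T + 2 / (c * T / u)"
        using zl zp T c lu by (intro add_mono divide_left_mono) (auto simp: field_simps)
      also have "\<dots> = (1 + 2 * u / c) / T" using c T lu by (simp add: field_simps)
      finally show "(1 + \<bar>z - 1\<bar>) / \<bar>z\<bar> \<le> (1 + 2 * u / c) / T" .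
    qed
    finally show ?thesis by (simp add: T_def)
  qed
  have up: "\<forall>\<^sub>F t in F. N0 r I (t *\<^sub>R w) \<le> ennreal (C2 * (1 / \<bar>t\<bar> powr e))"
    using roots small
  proof eventually_elim
    case (elim t)
    then obtain X where X: "finite X" "card X \<le> n" "\<And>s. s \<in> I \<Longrightarrow> slope s (t *\<^sub>R w) = 0 \<Longrightarrow>
        s \<in> X \<and> c * \<bar>t\<bar> powr e \<le> \<bar>slope1 s (t *\<^sub>R w)\<bar>" by blast
    define R where "R = equilibria r I (t *\<^sub>R w)"
    have RX: "R \<subseteq> X" using X(3) by (auto simp: R_def equilibria_eq)
    then have R: "finite R" "card R \<le> n" using X finite_subset card_mono[OF X(1) RX] by auto
    have "N0 r I (t *\<^sub>R w) = (\<Sum>s\<in>R. S0 r I (t *\<^sub>R w) s + U0 r I (t *\<^sub>R w) s)"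
      using R by (simp add: N0_def flip: R_def)
    also have "\<dots> \<le> (\<Sum>s\<in>R. ennreal ((1 + 2 * u / c) / \<bar>t\<bar> powr e))"
      by (rule sum_mono) (use w X(3) elim in \<open>auto simp: R_def equilibria_eq\<close>)
    also have "\<dots> = ennreal (real (card R)) * ennreal ((1 + 2 * u / c) / \<bar>t\<bar> powr e)"
      by (simp add: ennreal_of_nat_eq_real_of_nat)
    also have "\<dots> = ennreal (real (card R) * ((1 + 2 * u / c) / \<bar>t\<bar> powr e))"
      by (rule ennreal_mult'[symmetric]) simp
    also have "\<dots> \<le> ennreal (C2 * (1 / \<bar>t\<bar> powr e))"
    proof (rule ennreal_leI)
      have "real (card R) * ((1 + 2 * u / c) / \<bar>t\<bar> powr e) \<le> real (Suc n) * ((1 + 2 * u / c) / \<bar>t\<bar> powr e)"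
        by (rule mult_right_mono) (use R lu c in auto)
      then show "real (card R) * ((1 + 2 * u / c) / \<bar>t\<bar> powr e) \<le> C2 * (1 / \<bar>t\<bar> powr e)"
        by (simp add: C2_def)
    qed
    finally show ?case .
  qed
  have lo: "\<forall>\<^sub>F t in F. ennreal (C1 * (1 / \<bar>t\<bar> powr e)) \<le> N0 r I (t *\<^sub>R w)"
    using roots ex small
  proof eventually_elim
    case (elim t)
    then obtain X where X: "finite X" "\<And>s. s \<in> I \<Longrightarrow> slope s (t *\<^sub>R w) = 0 \<Longrightarrow>
        s \<in> X \<and> c * \<bar>t\<bar> powr e \<le> \<bar>slope1 s (t *\<^sub>R w)\<bar>" by blast
    obtain s where s: "s \<in> I" "slope s (t *\<^sub>R w) = 0" "\<bar>slope1 s (t *\<^sub>R w)\<bar> \<le> C * \<bar>t\<bar> powr e" using elim by blast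
    define R where "R = equilibria r I (t *\<^sub>R w)"
    have "R \<subseteq> X" using X(2) by (auto simp: R_def equilibria_eq)
    then have R: "finite R" using X finite_subset by auto
    have sR: "s \<in> R" using s by (simp add: R_def equilibria_eq)
    define z where "z = slope1 s (t *\<^sub>R w) / (r1 s \<bullet> r1 s)"
    define T where "T = \<bar>t\<bar> powr e"
    have T: "0 < T" using elim by (auto simp: T_def)
    have z: "1 + kappa_rho r I (t *\<^sub>R w) s = z"
      using index_denominator[OF s(1,2)] by (auto simp: z_def)
    have "c * T > 0" using c T by simp
    then have "\<bar>slope1 s (t *\<^sub>R w)\<bar> > 0" using X(2)[OF s(1,2)] unfolding T_def by linarith
    then have zp: "\<bar>z\<bar> > 0" using regular[OF s(1)] by (simp add: z_def)
    have "\<bar>z\<bar> = \<bar>slope1 s (t *\<^sub>R w)\<bar> / (r1 s \<bullet> r1 s)" by (simp add: z_def abs_divide)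
    also have "\<dots> \<le> C' * T / l"
    proof (rule frac_le)
      show "\<bar>slope1 s (t *\<^sub>R w)\<bar> \<le> C' * T"
        unfolding T_def C'_def by (rule order_trans[OF s(3)]) (simp add: mult_right_mono)
    qed (use v[OF s(1)] lu C' T in auto)
    finally have "1 / (C' * T / l) \<le> 1 / \<bar>z\<bar>"
      using zp by (intro divide_left_mono mult_pos_pos) auto
    then have "ennreal (C1 * (1 / T)) \<le> ennreal (1 / \<bar>z\<bar>)"
      using C' T lu by (intro ennreal_leI) (simp add: C1_def)
    also have "\<dots> = S0 r I (t *\<^sub>R w) s"
      using zp by (simp add: S0_def z divide_ennreal flip: ennreal_1)
    also have "\<dots> \<le> S0 r I (t *\<^sub>R w) s + U0 r I (t *\<^sub>R w) s" by simp
    also have "\<dots> \<le> (\<Sum>s\<in>R. S0 r I (t *\<^sub>R w) s + U0 r I (t *\<^sub>R w) s)"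
      by (rule member_le_sum[OF sR]) (use R in auto)
    also have "\<dots> = N0 r I (t *\<^sub>R w)"
      using R by (simp add: N0_def flip: R_def)
    finally show ?case by (simp add: T_def)
  qed
  have "C1 > 0" using lu C' by (simp add: C1_def)
  moreover have "\<forall>\<^sub>F t in F. ennreal (C1 * (1 / \<bar>t\<bar> powr e)) \<le> N0 r I (t *\<^sub>R w) \<and>
      N0 r I (t *\<^sub>R w) \<le> ennreal (C2 * (1 / \<bar>t\<bar> powr e))"
    using lo up by (rule eventually_conj)
  ultimately show ?thesis
    unfolding is_Theta_def using C2 by auto
qed

section \<open>The convex and the concave side of the evolute\<close>

text \<open>
  A normal vector cannot also be orthogonal to r'', since r' and r'' are independent at m.
\<close>

lemma tangent_direction_slope1:
  assumes "w \<noteq> 0" "w \<bullet> r1 m = 0"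
  shows "w \<bullet> r2 m \<noteq> 0"
proof
  assume "w \<bullet> r2 m = 0"
  then have "det2 (r1 m) w = 0"
    using assms inner_products_eq_frame[of "r1 m" w "r2 m"] det_m by (simp add: inner_commute)
  then have "(r1 m \<bullet> r1 m) * (w \<bullet> w) = 0"
    using assms inner_products_eq_frame[of "r1 m" w w] by (simp add: inner_commute)
  with assms r1_m show False by simp
qed

lemma center_tendsto: "(curvature_center r I \<longlongrightarrow> 0) (at m)"
proof -
  have l: "((\<lambda>s. slope s 0) \<longlongrightarrow> 0) (at m)" "((\<lambda>s. slope1 s 0) \<longlongrightarrow> 0) (at m)"
    using DERIV_isCont[OF slope_derivs_at(1)[of m 0]] DERIV_isCont[OF slope_derivs_at(2)[of m 0]]
    by (simp_all add: isCont_def)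
  have "((\<lambda>s. (slope1 s 0 / det2 (r1 s) (r2 s)) *\<^sub>R rot90 (r1 s) - (slope s 0 / det2 (r1 s) (r2 s)) *\<^sub>R rot90 (r2 s))
      \<longlongrightarrow> (0 / det2 (r1 m) (r2 m)) *\<^sub>R rot90 (r1 m) - (0 / det2 (r1 m) (r2 m)) *\<^sub>R rot90 (r2 m)) (at m)"
    by (intro tendsto_intros l frame_limits det_m)
  then have "((\<lambda>s. (slope1 s 0 / det2 (r1 s) (r2 s)) *\<^sub>R rot90 (r1 s) - (slope s 0 / det2 (r1 s) (r2 s)) *\<^sub>R rot90 (r2 s))
      \<longlongrightarrow> 0) (at m)" by simp
  then show ?thesis
  proof (rule Lim_transform_eventually)
    show "\<forall>\<^sub>F s in at m. (slope1 s 0 / det2 (r1 s) (r2 s)) *\<^sub>R rot90 (r1 s) - (slope s 0 / det2 (r1 s) (r2 s)) *\<^sub>R rot90 (r2 s)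
      = curvature_center r I s"
      using curvature_nz_near by eventually_elim (simp add: curvature_center_eq(1))
  qed
qed

lemma bounded_on_arc:
  assumes "continuous_on I h"
  obtains M where "M > 0" "\<And>s. s \<in> I \<Longrightarrow> norm (h s :: plane) \<le> M"
  using compact_imp_bounded[OF compact_continuous_image[OF assms]]
  by (auto simp: bounded_pos)

text \<open>
  The sides of the evolute are recognised from the slope, which is affine in the point q. Let
  \<sigma> be the second derivative of the slope at m. For q near the origin, \<sigma> slope is a strictly convex
  function of the parameter s near m. If q is on the evolute, this function has a double zero, so it is
  positive elsewhere. Hence a point where \<sigma> slope is negative for some s, or positive for all s,
  is off the evolute. The points of the second kind form a convex set P; those of the first kind
  with a common s form the part of a small disc on one side of the normal at s, called a half disc
  below.

  If w were tangent, then both halves of the path would meet half discs that contain the same point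
  q0, so A and B would coincide. If \<sigma> (w \<bullet> r' m) were negative, then the path would enter P for t > 0,
  so P would lie in B, while for t < 0 it would run in half discs, which put an arc of the evolute on
  the boundary of A. A chord of this arc has its midpoint in P, but it lies in the closure of the
  convex set A; so A would meet B.
\<close>

lemma evolute_sides_crossing:
  assumes s2: "slope2 m 0 \<noteq> 0" and "w \<noteq> 0" and sides: "evolute_sides r I m V A B"
    and left: "\<forall>\<^sub>F t in at_left 0. t *\<^sub>R w \<in> A" and right: "\<forall>\<^sub>F t in at_right 0. t *\<^sub>R w \<in> B"
  shows "slope2 m 0 * (w \<bullet> r1 m) > 0"
proof -
  define \<sigma> where "\<sigma> = slope2 m 0"
  define \<gamma> where "\<gamma> = w \<bullet> r1 m"
  let ?E = "evolute r I" and ?c = "curvature_center r I"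
  have \<sigma>: "\<sigma> \<noteq> 0" "\<sigma> * \<sigma> > 0" using s2 by (auto simp: \<sigma>_def zero_less_mult_iff linorder_neq_iff)
  have V: "open V" "0 \<in> V" and comps: "A \<in> components (V - ?E)" "B \<in> components (V - ?E)" "A \<noteq> B"
    and convA: "convex A"
    using sides by (auto simp: evolute_sides_def center_m)
  have disj: "A \<inter> B = {}" using components_nonoverlap[OF comps(1,2)] comps(3) by simp
  obtain M3 where M3: "M3 > 0" "\<And>s. s \<in> I \<Longrightarrow> norm (r3 s) \<le> M3"
    using bounded_on_arc[OF continuous_derivs(4)] by blast
  obtain M1 where M1: "M1 > 0" "\<And>s. s \<in> I \<Longrightarrow> norm (r1 s) \<le> M1"
    using bounded_on_arc[OF continuous_derivs(2)] by blast
  obtain \<eta> where \<eta>: "\<eta> > 0" and J: "\<And>s. \<bar>s - m\<bar> \<le> \<eta> \<Longrightarrow>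
     s \<in> {a<..<b} \<and> \<sigma> * slope2 s 0 > \<sigma> * \<sigma> / 2 \<and> (\<gamma> \<noteq> 0 \<longrightarrow> \<gamma> * (w \<bullet> r1 s) > 0)"
  proof -
    have "((\<lambda>s. \<sigma> * slope2 s 0) \<longlongrightarrow> \<sigma> * slope2 m 0) (nhds m)"
      using DERIV_isCont[OF slope_derivs_at(3)[of m 0]]
      by (intro tendsto_intros) (simp add: continuous_at tendsto_nhds_iff isCont_def)
    then have 1: "\<forall>\<^sub>F s in nhds m. \<sigma> * slope2 s 0 > \<sigma> * \<sigma> / 2"
      by (rule order_tendstoD) (use \<sigma> in \<open>simp flip: \<sigma>_def\<close>)
    have 2: "\<forall>\<^sub>F s in nhds m. \<gamma> \<noteq> 0 \<longrightarrow> \<gamma> * (w \<bullet> r1 s) > 0"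
    proof (cases "\<gamma> = 0")
      case False
      have "((\<lambda>s. \<gamma> * (w \<bullet> r1 s)) \<longlongrightarrow> \<gamma> * (w \<bullet> r1 m)) (nhds m)"
        using DERIV_isCont[OF velocity_component_derivs[of m w]]
        by (intro tendsto_mult tendsto_const) (simp add: tendsto_nhds_iff isCont_def)
      then have "\<forall>\<^sub>F s in nhds m. \<gamma> * (w \<bullet> r1 s) > 0"
        by (rule order_tendstoD) (use False in \<open>auto simp: zero_less_mult_iff linorder_neq_iff simp flip: \<gamma>_def\<close>)
      then show ?thesis by eventually_elim simp
    qed simp
    have "\<forall>\<^sub>F s in nhds m. s \<in> {a<..<b} \<and> \<sigma> * slope2 s 0 > \<sigma> * \<sigma> / 2 \<and> (\<gamma> \<noteq> 0 \<longrightarrow> \<gamma> * (w \<bullet> r1 s) > 0)"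
      using near_m 1 2 by eventually_elim auto
    then obtain d where d: "d > 0" "\<And>s. dist s m < d \<Longrightarrow>
       s \<in> {a<..<b} \<and> \<sigma> * slope2 s 0 > \<sigma> * \<sigma> / 2 \<and> (\<gamma> \<noteq> 0 \<longrightarrow> \<gamma> * (w \<bullet> r1 s) > 0)"
      unfolding eventually_nhds_metric by blast
    show ?thesis by (rule that[of "d / 2"]) (use d in \<open>auto simp: dist_real_def\<close>)
  qed
  define J where "J = {m - \<eta>..m + \<eta>}"
  have J_abs: "s \<in> J \<longleftrightarrow> \<bar>s - m\<bar> \<le> \<eta>" for s by (auto simp: J_def)
  have JI: "s \<in> I" "s \<in> {a<..<b}" if "s \<in> J" for s using J[of s] that by (auto simp: J_abs)
  have mJ: "m \<in> J" using \<eta> by (simp add: J_abs)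
  obtain \<delta>1 where \<delta>1: "\<delta>1 > 0" "\<And>s v. s \<in> I \<Longrightarrow> norm v < \<delta>1 \<Longrightarrow> slope s 0 = v \<bullet> r1 s \<Longrightarrow> \<bar>s - m\<bar> < \<eta>"
    using equilibria_localized[OF \<eta>] by blast
  obtain \<delta>2 where \<delta>2: "\<delta>2 > 0" "ball 0 \<delta>2 \<subseteq> V"
    using V by (auto simp: open_contains_ball)
  define \<delta> where "\<delta> = min (min \<delta>1 \<delta>2) (\<bar>\<sigma>\<bar> / (2 * M3))"
  have \<delta>: "\<delta> > 0" "\<delta> \<le> \<delta>1" "\<delta> \<le> \<delta>2" "\<delta> \<le> \<bar>\<sigma>\<bar> / (2 * M3)"
    using \<delta>1 \<delta>2 \<sigma> M3 by (auto simp: \<delta>_def)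
  have \<delta>V: "ball 0 \<delta> \<subseteq> V" using \<delta>(3) \<delta>2(2) by auto
  \<comment> \<open>For points near the origin, \<open>\<sigma> * slope\<close> stays strictly convex near \<open>m\<close>.\<close>
  have conv: "\<sigma> * slope2 s q > 0" if "s \<in> J" "norm q < \<delta>" for s q
  proof -
    have "\<sigma> * slope2 s q = \<sigma> * slope2 s 0 - \<sigma> * (q \<bullet> r3 s)"
      using slope_affine(2)[of s 0 q] by (simp add: right_diff_distrib)
    moreover have "\<bar>\<sigma> * (q \<bullet> r3 s)\<bar> \<le> \<sigma> * \<sigma> / 2"
    proof -
      have "\<bar>q \<bullet> r3 s\<bar> \<le> norm q * norm (r3 s)" by (rule Cauchy_Schwarz_ineq2)
      also have "\<dots> \<le> \<bar>\<sigma>\<bar> / (2 * M3) * M3"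
        using that \<delta> M3 JI by (intro mult_mono) auto
      also have "\<dots> = \<bar>\<sigma>\<bar> / 2" using M3 by simp
      finally have "\<bar>\<sigma>\<bar> * \<bar>q \<bullet> r3 s\<bar> \<le> \<bar>\<sigma>\<bar> * (\<bar>\<sigma>\<bar> / 2)" by (intro mult_left_mono) auto
      then show ?thesis by (simp add: abs_mult)
    qed
    moreover have "\<sigma> * slope2 s 0 > \<sigma> * \<sigma> / 2" using J[of s] that by (simp add: J_abs)
    ultimately show ?thesis by linarith
  qed
  have gap: "\<sigma> * slope u q > 0"
    if "v \<in> J" "u \<in> J" "u \<noteq> v" "norm q < \<delta>" "slope v q = 0" "slope1 v q = 0" for u v q
  proof (rule convex_double_zero_pos[where l = "m - \<eta>" and k = "m + \<eta>" and v = v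
        and h = "\<lambda>s. \<sigma> * slope s q" and h' = "\<lambda>s. \<sigma> * slope1 s q" and h'' = "\<lambda>s. \<sigma> * slope2 s q"])
    fix x assume "x \<in> {m - \<eta>..m + \<eta>}"
    then have "x \<in> J" by (simp add: J_def)
    note D = slope_derivs_at[OF JI(2)[OF this], of q]
    show "((\<lambda>s. \<sigma> * slope s q) has_real_derivative \<sigma> * slope1 x q) (at x)"
      by (rule DERIV_cmult[OF D(1)])
    show "((\<lambda>s. \<sigma> * slope1 s q) has_real_derivative \<sigma> * slope2 x q) (at x)"
      by (rule DERIV_cmult[OF D(2)])
    show "\<sigma> * slope2 x q > 0" using conv \<open>x \<in> J\<close> that by simp
  qed (use that in \<open>simp_all add: J_def\<close>)
  have center: "slope v (?c v) = 0" "slope1 v (?c v) = 0" if "v \<in> J" "curvature r I v \<noteq> 0" for v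
    using curvature_center_eq(2,3) JI that by auto
  have onE: "\<exists>v\<in>J. slope v q = 0 \<and> slope1 v q = 0" if q: "q \<in> ?E" "norm q < \<delta>" for q
  proof -
    obtain v where v: "v \<in> I" "curvature r I v \<noteq> 0" "q = ?c v"
      using q(1) by (auto simp: evolute_def evolute_params_def)
    have z: "slope v q = 0" "slope1 v q = 0" using curvature_center_eq(2,3) v by auto
    have "slope v 0 = q \<bullet> r1 v" using z(1) slope_affine(1)[of v 0 q] by simp
    moreover have "norm q < \<delta>1" using q(2) \<delta>(2) by simp
    ultimately have "\<bar>v - m\<bar> < \<eta>" using \<delta>1(2) v(1) by blast
    with z show ?thesis by (auto simp: J_abs)
  qed
  have halfplane: "{q. \<sigma> * slope s q < 0} = {q. (\<sigma> *\<^sub>R r1 s) \<bullet> q > \<sigma> * (r s \<bullet> r1 s)}"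
    "{q. \<sigma> * slope s q > 0} = {q. (\<sigma> *\<^sub>R r1 s) \<bullet> q < \<sigma> * (r s \<bullet> r1 s)}" for s
    by (auto simp: slope_def inner_diff_left inner_commute algebra_simps)
  \<comment> \<open>A half disc is connected and avoids the evolute, so it lies in one component.\<close>
  have transfer: "q2 \<in> C" if C: "C \<in> components (V - ?E)" "q1 \<in> C" and s: "s \<in> J"
      and q: "norm q1 < \<delta>" "norm q2 < \<delta>" "\<sigma> * slope s q1 < 0" "\<sigma> * slope s q2 < 0" for C q1 q2 s
  proof -
    define T where "T = ball 0 \<delta> \<inter> {q. \<sigma> * slope s q < 0}"
    have "convex T" unfolding T_def halfplane by (intro convex_Int convex_ball convex_halfspace_gt)
    then have "connected T" by (rule convex_connected)
    moreover have "T \<subseteq> V - ?E"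
    proof
      fix q assume "q \<in> T"
      then have q: "norm q < \<delta>" "\<sigma> * slope s q < 0" by (auto simp: T_def)
      have "q \<notin> ?E"
      proof
        assume "q \<in> ?E"
        then obtain v where v: "v \<in> J" "slope v q = 0" "slope1 v q = 0" using onE q by blast
        with gap[of v s q] s q show False by (cases "s = v") auto
      qed
      with q \<delta>V show "q \<in> V - ?E" by auto
    qed
    moreover have "C \<inter> T \<noteq> {}" using C q by (auto simp: T_def)
    ultimately have "T \<subseteq> C" using components_maximal C(1) by blast
    then show ?thesis using q by (auto simp: T_def)
  qed
  obtain d where d: "d > 0" and dA: "\<And>t. -d < t \<Longrightarrow> t < 0 \<Longrightarrow> t *\<^sub>R w \<in> A"
    and dB: "\<And>t. 0 < t \<Longrightarrow> t < d \<Longrightarrow> t *\<^sub>R w \<in> B" and dn: "\<And>t. \<bar>t\<bar> < d \<Longrightarrow> norm (t *\<^sub>R w) < \<delta>"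
  proof -
    obtain x where x: "x < 0" "\<And>t. x < t \<Longrightarrow> t < 0 \<Longrightarrow> t *\<^sub>R w \<in> A"
      using left eventually_at_left[of "-1::real" 0] by auto
    obtain y where y: "y > 0" "\<And>t. 0 < t \<Longrightarrow> t < y \<Longrightarrow> t *\<^sub>R w \<in> B"
      using right eventually_at_right[of 0 "1::real"] by auto
    show ?thesis
    proof (rule that[of "min (min (- x) y) (\<delta> / norm w)"])
      show "norm (t *\<^sub>R w) < \<delta>" if "\<bar>t\<bar> < min (min (- x) y) (\<delta> / norm w)" for t
        using that \<open>w \<noteq> 0\<close> by (simp add: field_simps)
    qed (use x y \<delta> \<open>w \<noteq> 0\<close> in auto)
  qed
  have \<gamma>: "\<gamma> \<noteq> 0"
  proof
    assume \<gamma>0: "\<gamma> = 0"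
    then have g1: "w \<bullet> r2 m \<noteq> 0" using tangent_direction_slope1 \<open>w \<noteq> 0\<close> by (simp add: \<gamma>_def)
    define n where "n = norm (\<sigma> *\<^sub>R r1 m)"
    have "n > 0" using \<sigma> r1_m by (simp add: n_def)
    define \<epsilon> where "\<epsilon> = \<delta> / (2 * n)"
    have "\<epsilon> > 0" using \<delta> \<open>n > 0\<close> by (simp add: \<epsilon>_def)
    \<comment> \<open>A point well inside the half disc at \<open>m\<close>, hence inside the half discs of all nearby parameters.\<close>
    define q0 where "q0 = \<epsilon> *\<^sub>R \<sigma> *\<^sub>R r1 m"
    have "norm q0 = \<epsilon> * n" using \<open>\<epsilon> > 0\<close> by (simp add: q0_def n_def abs_mult)
    also have "\<dots> = \<delta> / 2" using \<open>n > 0\<close> by (simp add: \<epsilon>_def)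
    finally have "norm q0 = \<delta> / 2" .
    then have nq0: "norm q0 < \<delta>" using \<delta> by simp
    have "\<sigma> * slope m q0 = - (\<epsilon> * (\<sigma> * \<sigma>) * (r1 m \<bullet> r1 m))"
      using slope_affine(1)[of m 0 q0] by (simp add: q0_def)
    also have "\<dots> < 0" using \<open>\<epsilon> > 0\<close> \<sigma> r1_m by simp
    finally have q0m: "\<sigma> * slope m q0 < 0" .
    have q0in: "q0 \<in> C" if t: "t \<noteq> 0" "\<bar>t\<bar> < d" "t *\<^sub>R w \<in> C" and C: "C \<in> components (V - ?E)" for t C
    proof -
      let ?h = "\<lambda>s. \<sigma> * slope s (t *\<^sub>R w)"
      have hd: "(?h has_real_derivative \<sigma> * slope1 m (t *\<^sub>R w)) (at m)"
        by (rule DERIV_cmult[OF slope_derivs_at(1)]) simp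
      have h0: "?h m = 0" using \<gamma>0 by (simp add: slope_line \<gamma>_def)
      have hd': "\<sigma> * slope1 m (t *\<^sub>R w) \<noteq> 0" using \<sigma> t g1 by (simp add: slope_line)
      have "((\<lambda>s. \<sigma> * slope s q0) \<longlongrightarrow> \<sigma> * slope m q0) (nhds m)"
        using DERIV_isCont[OF slope_derivs_at(1)[of m q0]]
        by (intro tendsto_intros) (simp add: tendsto_nhds_iff isCont_def)
      then have "\<forall>\<^sub>F s in nhds m. \<sigma> * slope s q0 < 0" using q0m by (rule order_tendstoD)
      then obtain d1 where d1: "d1 > 0" "\<And>s. \<bar>s - m\<bar> < d1 \<Longrightarrow> \<sigma> * slope s q0 < 0"
        by (auto simp: eventually_nhds_metric dist_real_def)
      \<comment> \<open>The slope has a simple zero at \<open>m\<close>, so \<open>\<sigma> * slope\<close> is negative on one side of it.\<close>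
      obtain d2 where d2: "d2 > 0" "(\<forall>x>0. x < d2 \<longrightarrow> ?h (m + x) < 0) \<or> (\<forall>x>0. x < d2 \<longrightarrow> ?h (m - x) < 0)"
      proof (cases "\<sigma> * slope1 m (t *\<^sub>R w) > 0")
        case True
        from DERIV_pos_inc_left[OF hd True] h0 show ?thesis using that by (simp del: mult_less_0_iff) metis
      next
        case False
        with hd' have "\<sigma> * slope1 m (t *\<^sub>R w) < 0" by linarith
        from DERIV_neg_dec_right[OF hd this] h0 show ?thesis using that by (simp del: mult_less_0_iff) metis
      qed
      define x where "x = min (min d1 d2) \<eta> / 2"
      have x: "0 < x" "x < d1" "x < d2" "x \<le> \<eta>" using d1 d2 \<eta> by (auto simp: x_def)
      from d2(2) x have "?h (m + x) < 0 \<or> ?h (m - x) < 0" by blast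
      moreover have "\<bar>m + x - m\<bar> = x" "\<bar>m - x - m\<bar> = x" using x by simp_all
      ultimately obtain s where s: "?h s < 0" "\<bar>s - m\<bar> = x" by blast
      then show ?thesis
        using transfer[OF C t(3), of s q0] x d1 nq0 dn[OF t(2)] by (simp add: J_abs)
    qed
    have "q0 \<in> A" using q0in[of "- (d / 2)" A] d dA[of "- (d / 2)"] comps(1) by simp
    moreover have "q0 \<in> B" using q0in[of "d / 2" B] d dB[of "d / 2"] comps(2) by simp
    ultimately show False using disj by blast
  qed
  have "\<sigma> * \<gamma> > 0"
  proof (rule ccontr)
    assume "\<not> \<sigma> * \<gamma> > 0"
    with \<gamma> \<sigma> have neg: "\<sigma> * \<gamma> < 0" by (metis linorder_neqE_linordered_idom mult_eq_0_iff)
    define p0 where "p0 = (- (d / 2)) *\<^sub>R w"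
    define p1 where "p1 = (d / 2) *\<^sub>R w"
    have p0: "p0 \<in> A" "norm p0 < \<delta>" using dA[of "- (d / 2)"] dn[of "- (d / 2)"] d by (auto simp: p0_def)
    have p1: "p1 \<in> B" "norm p1 < \<delta>" using dB[of "d/2"] dn[of "d/2"] d by (auto simp: p1_def)
    have "\<sigma> * slope m p0 = d / 2 * (\<sigma> * \<gamma>)"
      unfolding p0_def slope_line by (simp add: \<gamma>_def)
    also have "\<dots> < 0" using d neg by (simp only: mult_pos_neg half_gt_zero)
    finally have p0m: "\<sigma> * slope m p0 < 0" .
    define P where "P = ball 0 \<delta> \<inter> (\<Inter>s\<in>J. {q. \<sigma> * slope s q > 0})"
    have "convex P"
      unfolding P_def halfplane by (intro convex_Int convex_ball convex_INT convex_halfspace_lt)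
    then have "connected P" by (rule convex_connected)
    moreover have "P \<subseteq> V - ?E"
    proof
      fix q assume "q \<in> P"
      then have q: "norm q < \<delta>" "\<And>s. s \<in> J \<Longrightarrow> \<sigma> * slope s q > 0" by (auto simp: P_def)
      then have "q \<notin> ?E" using onE by fastforce
      with q \<delta>V show "q \<in> V - ?E" by auto
    qed
    moreover have "p1 \<in> P"
    proof -
      have "\<sigma> * slope s p1 > 0" if s: "s \<in> J" for s
      proof -
        have "\<sigma> * slope s 0 \<ge> 0"
          using gap[of m s 0] s mJ \<delta> by (cases "s = m") auto
        moreover have "\<sigma> * (w \<bullet> r1 s) < 0"
          using J[of s] s \<gamma> neg by (auto simp: J_abs mult_less_0_iff zero_less_mult_iff)
        then have "d / 2 * (\<sigma> * (w \<bullet> r1 s)) < 0" using d by (simp only: mult_pos_neg half_gt_zero)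
        ultimately show ?thesis by (simp add: p1_def slope_line algebra_simps)
      qed
      with p1 show ?thesis by (simp add: P_def)
    qed
    ultimately have PB: "P \<subseteq> B" using components_maximal[OF comps(2)] p1 by blast
    \<comment> \<open>The segment from \<open>p0\<close> to an evolute point with parameter \<open>u\<close> stays in the half disc of \<open>u\<close>, apart from its end.\<close>
    have clA: "?c u \<in> closure A"
      if u: "u \<in> J" "curvature r I u \<noteq> 0" "norm (?c u) < \<delta>" "\<sigma> * slope u p0 < 0" for u
      unfolding closure_approachable
    proof (intro allI impI)
      fix e :: real assume "e > 0"
      define \<theta> where "\<theta> = min 1 (e / (2 * (norm (p0 - ?c u) + 1)))"
      have \<theta>: "0 < \<theta>" "\<theta> \<le> 1" using \<open>e > 0\<close> by (auto simp: \<theta>_def add_nonneg_pos)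
      define q where "q = ?c u + \<theta> *\<^sub>R (p0 - ?c u)"
      have "q = (1 - \<theta>) *\<^sub>R ?c u + \<theta> *\<^sub>R p0" by (simp add: q_def algebra_simps)
      then have "q \<in> ball 0 \<delta>"
        using convexD_alt[OF convex_ball[of 0 \<delta>], of "?c u" p0 \<theta>] \<theta> u p0 by auto
      moreover have "\<sigma> * slope u q = \<theta> * (\<sigma> * slope u p0)"
        using slope_affine(1)[of u "?c u" "p0 - ?c u"] center(1)[OF u(1,2)]
        by (simp add: q_def slope_affine(1))
      then have "\<sigma> * slope u q < 0" using \<theta>(1) u(4) by (simp only: mult_pos_neg)
      ultimately have "q \<in> A" using transfer[OF comps(1) p0(1) u(1) p0(2)] u(4) by auto
      moreover have "dist q (?c u) < e"
      proof -
        have "dist q (?c u) = \<theta> * norm (p0 - ?c u)" using \<theta> by (simp add: q_def dist_norm)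
        also have "\<dots> \<le> e / (2 * (norm (p0 - ?c u) + 1)) * (norm (p0 - ?c u) + 1)"
          by (rule mult_mono) (use \<open>e > 0\<close> in \<open>auto simp: \<theta>_def\<close>)
        also have "\<dots> = e / 2" using norm_ge_zero[of "p0 - ?c u"] by (simp add: field_simps add_nonneg_eq_0_iff)
        finally show ?thesis using \<open>e > 0\<close> by simp
      qed
      ultimately show "\<exists>y\<in>A. dist y (?c u) < e" by blast
    qed
    have "\<forall>\<^sub>F u in at m. u \<noteq> m \<and> u \<in> J \<and> curvature r I u \<noteq> 0 \<and> norm (?c u) < \<delta> \<and> \<sigma> * slope u p0 < 0"
    proof (intro eventually_conj)
      show "\<forall>\<^sub>F u in at m. u \<noteq> m" by (simp add: eventually_at_filter)
      show "\<forall>\<^sub>F u in at m. u \<in> J"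
        unfolding eventually_at by (rule exI[of _ \<eta>]) (use \<eta> in \<open>auto simp: J_abs dist_real_def\<close>)
      show "\<forall>\<^sub>F u in at m. curvature r I u \<noteq> 0" using curvature_nz_near by eventually_elim simp
      show "\<forall>\<^sub>F u in at m. norm (?c u) < \<delta>"
        using tendstoD[OF center_tendsto \<delta>(1)] by simp
      have "((\<lambda>s. \<sigma> * slope s p0) \<longlongrightarrow> \<sigma> * slope m p0) (at m)"
        using DERIV_isCont[OF slope_derivs_at(1)[of m p0]]
        by (intro tendsto_intros) (simp add: isCont_def)
      then show "\<forall>\<^sub>F u in at m. \<sigma> * slope u p0 < 0" using p0m by (rule order_tendstoD)
    qed
    from eventually_happens[OF this] obtain u where u: "u \<noteq> m" "u \<in> J" "curvature r I u \<noteq> 0" "norm (?c u) < \<delta>" "\<sigma> * slope u p0 < 0"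
      by auto
    \<comment> \<open>Half of the chord from the origin, which is the centre of curvature at \<open>m\<close>.\<close>
    define mid where "mid = (1 / 2) *\<^sub>R ?c u"
    have km: "curvature r I m \<noteq> 0" using det_m r1_m by (simp add: curvature_eq)
    have "?c m \<in> closure A" using clA[OF mJ km] p0m \<delta> by (simp add: center_m)
    then have midA: "mid \<in> closure A"
      using convexD_alt[OF convex_closure[OF convA], of "?c m" "?c u" "1/2"] clA[OF u(2-5)]
      by (simp add: mid_def center_m)
    have "\<sigma> * slope s mid > 0" if s: "s \<in> J" for s
    proof -
      have "slope s mid = (slope s 0 + slope s (?c u)) / 2"
        using slope_affine(1)[of s 0 "?c u"] slope_affine(1)[of s 0 mid] by (simp add: mid_def field_simps)
      then have mid2: "\<sigma> * slope s mid = (\<sigma> * slope s 0 + \<sigma> * slope s (?c u)) / 2" by (simp add: field_simps)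
      have "s \<noteq> m \<Longrightarrow> \<sigma> * slope s 0 > 0" using gap[of m s 0] s mJ \<delta> by auto
      moreover have "s \<noteq> u \<Longrightarrow> \<sigma> * slope s (?c u) > 0" using gap[of u s "?c u"] s u center by auto
      ultimately have "\<sigma> * slope s 0 + \<sigma> * slope s (?c u) > 0"
        using u(1) center(1)[OF u(2,3)] by (cases "s = m"; cases "s = u") auto
      then show ?thesis unfolding mid2 by (rule half_gt_zero)
    qed
    moreover have "continuous_on J (\<lambda>s. \<sigma> * slope s mid)"
      by (intro continuous_intros continuous_on_subset[OF continuous_slopes(1)]) (use JI in auto)
    moreover have "compact J" "J \<noteq> {}" using mJ by (auto simp: J_def)
    ultimately obtain \<mu> where \<mu>: "\<mu> > 0" "\<And>s. s \<in> J \<Longrightarrow> \<mu> \<le> \<sigma> * slope s mid"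
      using continuous_attains_inf[of J "\<lambda>s. \<sigma> * slope s mid"] by metis
    have nm: "norm mid < \<delta>" using u(4) \<delta> by (simp add: mid_def)
    have "min (\<mu> / (\<bar>\<sigma>\<bar> * M1)) (\<delta> - norm mid) > 0" using \<mu> \<sigma> M1 nm by simp
    with midA obtain q where q: "q \<in> A" "dist q mid < min (\<mu> / (\<bar>\<sigma>\<bar> * M1)) (\<delta> - norm mid)"
      unfolding closure_approachable by blast
    have "q \<in> P"
    proof -
      have "norm q < \<delta>" using q(2) norm_triangle_ineq2[of q mid] by (simp add: dist_norm)
      moreover have "\<sigma> * slope s q > 0" if s: "s \<in> J" for s
      proof -
        have "\<bar>\<sigma> * ((q - mid) \<bullet> r1 s)\<bar> \<le> \<bar>\<sigma>\<bar> * (norm (q - mid) * norm (r1 s))"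
          using Cauchy_Schwarz_ineq2[of "q - mid" "r1 s"] by (simp add: abs_mult mult_left_mono)
        also have "\<dots> \<le> \<bar>\<sigma>\<bar> * (norm (q - mid) * M1)"
          using M1(2)[OF JI(1)[OF s]] by (intro mult_left_mono) auto
        also have "\<dots> < \<mu>" using q(2) \<sigma> M1 by (simp add: dist_norm field_simps)
        finally have "\<bar>\<sigma> * ((q - mid) \<bullet> r1 s)\<bar> < \<mu>" .
        moreover have "\<sigma> * slope s q = \<sigma> * slope s mid - \<sigma> * ((q - mid) \<bullet> r1 s)"
          using slope_affine(1)[of s mid "q - mid"] by (simp add: right_diff_distrib)
        ultimately show ?thesis using \<mu>(2)[OF s] by linarith
      qed
      ultimately show ?thesis by (simp add: P_def)
    qed
    with PB q disj show False by blast
  qed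
  then show ?thesis by (simp add: \<sigma>_def \<gamma>_def)
qed

section \<open>Equilibria on a straight path through the evolute\<close>

text \<open>
  The velocity component along w vanishes at m to order i. The condition on its derivative carries
  the factor s - m so that it makes sense for i = 0, where the limit is 0.
\<close>

definition component_order :: "plane \<Rightarrow> nat \<Rightarrow> real \<Rightarrow> bool" where
  "component_order w i B \<longleftrightarrow> B \<noteq> 0 \<and>
     ((\<lambda>s. (w \<bullet> r1 s) / (s - m) ^ i) \<longlongrightarrow> B) (at m) \<and>
     ((\<lambda>s. (w \<bullet> r2 s) * (s - m) / (s - m) ^ i) \<longlongrightarrow> real i * B) (at m)"

lemma r2_component_tendsto: "((\<lambda>s. w \<bullet> r2 s) \<longlongrightarrow> w \<bullet> r2 m) (at m)"
proof -
  have "isCont r2 m"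
    using derivs(3)[OF mI(1)] by (auto simp: at_interior intro: has_vector_derivative_continuous)
  then show ?thesis by (intro tendsto_intros) (simp add: isCont_def)
qed

lemma component_order_zero:
  assumes "w \<bullet> r1 m \<noteq> 0"
  shows "component_order w 0 (w \<bullet> r1 m)"
proof -
  have "((\<lambda>s. w \<bullet> r1 s) \<longlongrightarrow> w \<bullet> r1 m) (at m)"
    using DERIV_isCont[OF velocity_component_derivs[of m w]] by (simp add: isCont_def)
  moreover have "((\<lambda>s. (w \<bullet> r2 s) * (s - m)) \<longlongrightarrow> (w \<bullet> r2 m) * (m - m)) (at m)"
    by (intro tendsto_mult tendsto_diff tendsto_const tendsto_ident_at r2_component_tendsto)
  ultimately show ?thesis using assms by (simp add: component_order_def)
qed

lemma component_order_one:
  assumes "w \<bullet> r1 m = 0" "w \<noteq> 0"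
  shows "component_order w 1 (w \<bullet> r2 m)"
proof -
  have "((\<lambda>s. (w \<bullet> r1 s) / (s - m)) \<longlongrightarrow> w \<bullet> r2 m) (at m)"
    by (rule derivative_quotient_limit[OF velocity_component_derivs]) (use assms in auto)
  moreover have "((\<lambda>s. (w \<bullet> r2 s) * (s - m) / (s - m) ^ 1) \<longlongrightarrow> w \<bullet> r2 m) (at m)"
    by (rule Lim_transform_eventually[OF r2_component_tendsto]) (auto simp: eventually_at_filter)
  ultimately show ?thesis
    using tangent_direction_slope1 assms by (simp add: component_order_def)
qed

lemma equilibria_near_m:
  assumes f: "slope_order j A" and g: "component_order w i B" and "i < j"
    and e_def: "e = (real j - 1) / (real j - real i)"
  obtains c C \<delta> where "c > 0" "C > 0" "\<delta> > 0"
    and "\<And>t. \<bar>t\<bar> < \<delta> \<Longrightarrow> \<exists>X. finite X \<and> card X \<le> 3 \<and>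
       (\<forall>s\<in>I. slope s (t *\<^sub>R w) = 0 \<longrightarrow> s \<in> X)"
    and "\<And>t s. \<bar>t\<bar> < \<delta> \<Longrightarrow> s \<in> I \<Longrightarrow> slope s (t *\<^sub>R w) = 0 \<Longrightarrow> s \<noteq> m \<Longrightarrow>
       c * \<bar>t\<bar> powr e \<le> \<bar>slope1 s (t *\<^sub>R w)\<bar> \<and>
       \<bar>slope1 s (t *\<^sub>R w)\<bar> \<le> C * \<bar>t\<bar> powr e \<and>
       A * B * t * (s - m) ^ (j - i) > 0"
proof -
  obtain \<eta> c C where c: "\<eta> > 0" "c > 0" "C > 0"
    and size: "\<And>s t. 0 < \<bar>s - m\<bar> \<Longrightarrow> \<bar>s - m\<bar> < \<eta> \<Longrightarrow> slope s 0 = t * (w \<bullet> r1 s) \<Longrightarrow>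
           c * \<bar>t\<bar> powr e \<le> \<bar>slope1 s 0 - t * (w \<bullet> r2 s)\<bar> \<and>
           \<bar>slope1 s 0 - t * (w \<bullet> r2 s)\<bar> \<le> C * \<bar>t\<bar> powr e
           \<and> A * B * t * (s - m) ^ (j - i) > 0"
    and inj: "\<And>s s' t. m < s \<and> m < s' \<or> s < m \<and> s' < m \<Longrightarrow> \<bar>s - m\<bar> < \<eta> \<Longrightarrow> \<bar>s' - m\<bar> < \<eta> \<Longrightarrow>
           slope s 0 = t * (w \<bullet> r1 s) \<Longrightarrow> slope s' 0 = t * (w \<bullet> r1 s') \<Longrightarrow> s = s'"
  proof (rule root_slope_scaling[where m = m, OF \<open>i < j\<close>, of A B "\<lambda>s. slope s 0" "\<lambda>s. slope1 s 0" "\<lambda>s. w \<bullet> r1 s" "\<lambda>s. w \<bullet> r2 s"])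
    show "\<forall>\<^sub>F s in nhds m. ((\<lambda>s. w \<bullet> r1 s) has_real_derivative w \<bullet> r2 s) (at s)"
      by (rule eventually_mono[OF near_m velocity_component_derivs])
  qed (use f g slope_derivs_near in \<open>auto simp: slope_order_def component_order_def e_def\<close>)
  obtain \<delta>1 where \<delta>1: "\<delta>1 > 0" "\<And>s v. s \<in> I \<Longrightarrow> norm v < \<delta>1 \<Longrightarrow> slope s 0 = v \<bullet> r1 s \<Longrightarrow> \<bar>s - m\<bar> < \<eta>"
    using equilibria_localized[OF c(1)] by blast
  define \<delta> where "\<delta> = \<delta>1 / (norm w + 1)"
  have nw: "norm w + 1 > 0" using norm_ge_zero[of w] by linarith
  have near: "\<bar>s - m\<bar> < \<eta>" "slope s 0 = t * (w \<bullet> r1 s)" if "\<bar>t\<bar> < \<delta>" "s \<in> I" "slope s (t *\<^sub>R w) = 0" for s t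
  proof -
    show eq: "slope s 0 = t * (w \<bullet> r1 s)" using that by (simp add: slope_line)
    have "norm (t *\<^sub>R w) \<le> \<bar>t\<bar> * (norm w + 1)" by (simp add: algebra_simps)
    also have "\<dots> < \<delta>1" using that(1) nw by (simp add: \<delta>_def field_simps)
    finally show "\<bar>s - m\<bar> < \<eta>" using \<delta>1(2)[OF that(2), of "t *\<^sub>R w"] eq by simp
  qed
  show ?thesis
  proof (rule that)
    show "c > 0" "C > 0" "\<delta> > 0" using c \<delta>1 nw by (auto simp: \<delta>_def)
    fix t assume t: "\<bar>t\<bar> < \<delta>"
    define R where "R = {s \<in> I. slope s (t *\<^sub>R w) = 0}"
    have uniq: "s = s'" if "s \<in> R" "s' \<in> R" "m < s \<and> m < s' \<or> s < m \<and> s' < m" for s s'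
      using inj[of s s' t] near[OF t, of s] near[OF t, of s'] that by (auto simp: R_def)
    obtain x where x: "\<And>s. s \<in> R \<Longrightarrow> m < s \<Longrightarrow> s = x" using uniq by metis
    obtain y where y: "\<And>s. s \<in> R \<Longrightarrow> s < m \<Longrightarrow> s = y" using uniq by metis
    have "card (set [m, x, y]) \<le> length [m, x, y]" by (rule card_length)
    moreover have "R \<subseteq> set [m, x, y]"
    proof
      fix s assume "s \<in> R" then show "s \<in> set [m, x, y]"
        using x y by (cases s m rule: linorder_cases) auto
    qed
    ultimately show "\<exists>X. finite X \<and> card X \<le> 3 \<and> (\<forall>s\<in>I. slope s (t *\<^sub>R w) = 0 \<longrightarrow> s \<in> X)"
      by (intro exI[of _ "set [m, x, y]"]) (auto simp: R_def)
  next
    fix t s assume t: "\<bar>t\<bar> < \<delta>" "s \<in> I" "slope s (t *\<^sub>R w) = 0" "s \<noteq> m"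
    show "c * \<bar>t\<bar> powr e \<le> \<bar>slope1 s (t *\<^sub>R w)\<bar> \<and>
       \<bar>slope1 s (t *\<^sub>R w)\<bar> \<le> C * \<bar>t\<bar> powr e \<and>
       A * B * t * (s - m) ^ (j - i) > 0"
      using size[of s t] near[OF t(1-3)] t(4) by (simp add: slope_line e_def)
  qed
qed

lemma eventually_abs_small: "\<delta> > 0 \<Longrightarrow> \<forall>\<^sub>F t in at (0::real). t \<noteq> 0 \<and> \<bar>t\<bar> < \<delta>"
  by (auto simp: eventually_at dist_real_def)

text \<open>
  In a normal direction m stays an equilibrium for all t, and its slope derivative is
  - t (w \<bullet> r'' m). This alone gives the lower bound. The other equilibria have slopes of the same
  order |t|, whatever the order j.
\<close>

lemma tangent_N0_Theta:
  assumes f: "slope_order j A" and w: "w \<noteq> 0" "w \<bullet> r1 m = 0"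
  shows "is_Theta (at 0) (\<lambda>t. N0 r I (t *\<^sub>R w)) (\<lambda>t. 1 / \<bar>t\<bar>)"
proof -
  have j: "2 \<le> j" using f by (simp add: slope_order_def)
  have e: "(real j - 1) / (real j - real 1) = 1" using j by simp
  obtain c C \<delta> where c: "c > 0" "C > 0" "\<delta> > 0"
    and card: "\<And>t. \<bar>t\<bar> < \<delta> \<Longrightarrow> \<exists>X. finite X \<and> card X \<le> 3 \<and> (\<forall>s\<in>I. slope s (t *\<^sub>R w) = 0 \<longrightarrow> s \<in> X)"
    and size: "\<And>t s. \<bar>t\<bar> < \<delta> \<Longrightarrow> s \<in> I \<Longrightarrow> slope s (t *\<^sub>R w) = 0 \<Longrightarrow> s \<noteq> m \<Longrightarrow>
       c * \<bar>t\<bar> powr 1 \<le> \<bar>slope1 s (t *\<^sub>R w)\<bar> \<and> \<bar>slope1 s (t *\<^sub>R w)\<bar> \<le> C * \<bar>t\<bar> powr 1 \<and>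
       A * (w \<bullet> r2 m) * t * (s - m) ^ (j - 1) > 0"
    by (rule equilibria_near_m[OF f component_order_one[OF w(2,1)] _ e[symmetric]]) (use j in simp, rule that)
  define G where "G = \<bar>w \<bullet> r2 m\<bar>"
  have G: "G > 0" using tangent_direction_slope1 w by (simp add: G_def)
  have slm: "slope m (t *\<^sub>R w) = 0" "\<bar>slope1 m (t *\<^sub>R w)\<bar> = G * \<bar>t\<bar>" for t
    using w by (simp_all add: slope_line G_def abs_mult)
  have "is_Theta (at 0) (\<lambda>t. N0 r I (t *\<^sub>R w)) (\<lambda>t. 1 / \<bar>t\<bar> powr 1)"
  proof (rule N0_Theta[where c = "min c G" and C = G and n = 3])
    show "\<forall>\<^sub>F t in at 0. \<exists>X. finite X \<and> card X \<le> 3 \<and> (\<forall>s\<in>I. slope s (t *\<^sub>R w) = 0 \<longrightarrow>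
        s \<in> X \<and> min c G * \<bar>t\<bar> powr 1 \<le> \<bar>slope1 s (t *\<^sub>R w)\<bar>)"
      using eventually_abs_small[OF c(3)]
    proof eventually_elim
      case (elim t)
      then obtain X where X: "finite X" "card X \<le> 3" "\<And>s. s \<in> I \<Longrightarrow> slope s (t *\<^sub>R w) = 0 \<Longrightarrow> s \<in> X"
        using card[of t] by blast
      have "min c G * \<bar>t\<bar> powr 1 \<le> \<bar>slope1 s (t *\<^sub>R w)\<bar>" if "s \<in> I" "slope s (t *\<^sub>R w) = 0" for s
      proof (cases "s = m")
        case True
        then show ?thesis by (simp add: slm mult_right_mono)
      next
        case False
        have "min c G * \<bar>t\<bar> powr 1 \<le> c * \<bar>t\<bar> powr 1" by (intro mult_right_mono) auto
        moreover have "c * \<bar>t\<bar> powr 1 \<le> \<bar>slope1 s (t *\<^sub>R w)\<bar>"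
          using size[of t s] that False elim by blast
        ultimately show ?thesis by linarith
      qed
      with X show ?case by blast
    qed
    show "\<forall>\<^sub>F t in at 0. \<exists>s\<in>I. slope s (t *\<^sub>R w) = 0 \<and> \<bar>slope1 s (t *\<^sub>R w)\<bar> \<le> G * \<bar>t\<bar> powr 1"
      by (intro always_eventually allI bexI[of _ m]) (simp_all add: slm)
  qed (use c G in auto)
  then show ?thesis by simp
qed

lemma transversal_N0_Theta:
  assumes f: "slope_order j A" and w: "w \<bullet> r1 m \<noteq> 0" and F: "F \<le> at 0"
    and ex: "\<forall>\<^sub>F t in F. \<exists>s\<in>I. slope s (t *\<^sub>R w) = 0"
  shows "is_Theta F (\<lambda>t. N0 r I (t *\<^sub>R w)) (\<lambda>t. 1 / \<bar>t\<bar> powr ((real j - 1) / real j))"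
proof -
  have j: "2 \<le> j" using f by (simp add: slope_order_def)
  have e: "(real j - 1) / (real j - real 0) = (real j - 1) / real j" by simp
  obtain c C \<delta> where c: "c > 0" "C > 0" "\<delta> > 0"
    and card: "\<And>t. \<bar>t\<bar> < \<delta> \<Longrightarrow> \<exists>X. finite X \<and> card X \<le> 3 \<and> (\<forall>s\<in>I. slope s (t *\<^sub>R w) = 0 \<longrightarrow> s \<in> X)"
    and size: "\<And>t s. \<bar>t\<bar> < \<delta> \<Longrightarrow> s \<in> I \<Longrightarrow> slope s (t *\<^sub>R w) = 0 \<Longrightarrow> s \<noteq> m \<Longrightarrow>
       c * \<bar>t\<bar> powr ((real j - 1) / real j) \<le> \<bar>slope1 s (t *\<^sub>R w)\<bar> \<and>
       \<bar>slope1 s (t *\<^sub>R w)\<bar> \<le> C * \<bar>t\<bar> powr ((real j - 1) / real j) \<and>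
       A * (w \<bullet> r1 m) * t * (s - m) ^ (j - 0) > 0"
    by (rule equilibria_near_m[OF f component_order_zero[OF w] _ e[symmetric]]) (use j in simp, rule that)
  have small: "\<forall>\<^sub>F t in F. t \<noteq> 0 \<and> \<bar>t\<bar> < \<delta>"
    by (rule filter_leD[OF F eventually_abs_small[OF c(3)]])
  have not_m: "s \<noteq> m" if "t \<noteq> 0" "slope s (t *\<^sub>R w) = 0" for s t
    using that w by (auto simp: slope_line)
  show ?thesis
  proof (rule N0_Theta[where c = c and C = C and n = 3])
    show "\<forall>\<^sub>F t in F. \<exists>X. finite X \<and> card X \<le> 3 \<and> (\<forall>s\<in>I. slope s (t *\<^sub>R w) = 0 \<longrightarrow>
        s \<in> X \<and> c * \<bar>t\<bar> powr ((real j - 1) / real j) \<le> \<bar>slope1 s (t *\<^sub>R w)\<bar>)"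
      using small
    proof eventually_elim
      case (elim t)
      then obtain X where "finite X" "card X \<le> 3" "\<And>s. s \<in> I \<Longrightarrow> slope s (t *\<^sub>R w) = 0 \<Longrightarrow> s \<in> X"
        using card[of t] by blast
      with elim size[of t] not_m[of t] show ?case by blast
    qed
    show "\<forall>\<^sub>F t in F. \<exists>s\<in>I. slope s (t *\<^sub>R w) = 0 \<and> \<bar>slope1 s (t *\<^sub>R w)\<bar> \<le> C * \<bar>t\<bar> powr ((real j - 1) / real j)"
      using small ex by eventually_elim (use size not_m in blast)
  qed (use c F j in auto)
qed

text \<open>
  For small t the sign of the slope at s1 is that of slope s1 0, and at m it is that of
  - t (w \<bullet> r' m). If these differ, the slope has a zero.
\<close>

lemma equilibrium_exists:
  assumes s1: "s1 \<in> I" "slope s1 0 \<noteq> 0"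
  obtains \<delta> where "\<delta> > 0"
    and "\<And>t. \<bar>t\<bar> < \<delta> \<Longrightarrow> slope s1 0 * (t * (w \<bullet> r1 m)) > 0 \<Longrightarrow> \<exists>s\<in>I. slope s (t *\<^sub>R w) = 0"
proof -
  define S where "S = slope s1 0"
  have S: "S \<noteq> 0" "S * S > 0" using s1 by (auto simp: S_def zero_less_mult_iff linorder_neq_iff)
  define K where "K = \<bar>S * (w \<bullet> r1 s1)\<bar> + 1"
  have "K > 0" by (simp add: K_def add_nonneg_pos)
  show ?thesis
  proof (rule that[of "S * S / K"])
    show "S * S / K > 0" using S \<open>K > 0\<close> by (simp only: divide_pos_pos)
    fix t assume t: "\<bar>t\<bar> < S * S / K" "slope s1 0 * (t * (w \<bullet> r1 m)) > 0"
    have "\<bar>t * (S * (w \<bullet> r1 s1))\<bar> = \<bar>t\<bar> * \<bar>S * (w \<bullet> r1 s1)\<bar>" by (simp add: abs_mult)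
    also have "\<dots> \<le> \<bar>t\<bar> * K" by (rule mult_left_mono) (simp_all add: K_def)
    also have "\<dots> < S * S" using t(1) \<open>K > 0\<close> by (simp add: field_simps)
    finally have "t * (S * (w \<bullet> r1 s1)) \<le> S * S" by linarith
    then have up: "0 \<le> S * slope s1 (t *\<^sub>R w)"
      by (simp add: slope_line algebra_simps flip: S_def)
    have lo: "S * slope m (t *\<^sub>R w) \<le> 0"
      using t(2) by (simp add: slope_line flip: S_def)
    have "continuous_on I (\<lambda>s. S * slope s (t *\<^sub>R w))"
      by (intro continuous_intros continuous_slopes)
    then have connected: "connected ((\<lambda>s. S * slope s (t *\<^sub>R w)) ` I)"
      by (rule connected_continuous_image) simp
    have "0 \<in> (\<lambda>s. S * slope s (t *\<^sub>R w)) ` I"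
      by (rule connectedD_interval[OF connected imageI[OF mI(1)] imageI[OF s1(1)] lo up])
    then obtain s where "s \<in> I" "0 = S * slope s (t *\<^sub>R w)" by (rule imageE)
    with S show "\<exists>s\<in>I. slope s (t *\<^sub>R w) = 0" by auto
  qed
qed

lemma slope_sign:
  assumes "slope_order j A"
  shows "\<forall>\<^sub>F s in at m. s \<in> I \<and> A * slope s 0 * (s - m) ^ j > 0"
proof -
  have A: "A \<noteq> 0" "((\<lambda>s. slope s 0 / (s - m) ^ j) \<longlongrightarrow> A) (at m)" using assms by (auto simp: slope_order_def)
  have "((\<lambda>s. A * (slope s 0 / (s - m) ^ j)) \<longlongrightarrow> A * A) (at m)" by (intro tendsto_mult tendsto_const A)
  then have "\<forall>\<^sub>F s in at m. A * (slope s 0 / (s - m) ^ j) > 0"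
    by (rule order_tendstoD) (use A in \<open>auto simp: zero_less_mult_iff linorder_neq_iff\<close>)
  then show ?thesis
    using curvature_nz_near
    by eventually_elim (auto simp: zero_less_mult_iff zero_less_divide_iff mult_less_0_iff divide_less_0_iff)
qed

lemma slope_right_of_m:
  assumes "slope_order j A"
  obtains s1 where "s1 \<in> I" "A * slope s1 0 > 0"
proof -
  have "\<forall>\<^sub>F s in at_right m. s \<in> I \<and> A * slope s 0 * (s - m) ^ j > 0"
    using slope_sign[OF assms] by (simp add: eventually_at_split)
  then have "\<forall>\<^sub>F s in at_right m. s \<in> I \<and> A * slope s 0 * (s - m) ^ j > 0 \<and> m < s"
    using eventually_at_right_less[of m] by eventually_elim auto
  from eventually_happens[OF this] obtain s where s: "s \<in> I" "A * slope s 0 * (s - m) ^ j > 0" "m < s" by auto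
  from s(3) have "(s - m) ^ j > 0" by simp
  with s(2) have "A * slope s 0 > 0" by (rule zero_less_mult_pos2)
  with s(1) show ?thesis by (rule that)
qed

lemma slope_left_of_m:
  assumes "slope_order j A" "odd j"
  obtains s2 where "s2 \<in> I" "A * slope s2 0 < 0"
proof -
  have "\<forall>\<^sub>F s in at_left m. s \<in> I \<and> A * slope s 0 * (s - m) ^ j > 0"
    using slope_sign[OF assms(1)] by (simp add: eventually_at_split)
  moreover have "\<forall>\<^sub>F s in at_left m. s < m" by (simp add: eventually_at_filter)
  ultimately have "\<forall>\<^sub>F s in at_left m. s \<in> I \<and> A * slope s 0 * (s - m) ^ j > 0 \<and> s < m"
    by eventually_elim auto
  from eventually_happens[OF this] obtain s where s: "s \<in> I" "A * slope s 0 * (s - m) ^ j > 0" "s < m" by auto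
  from s(3) have "(s - m) ^ j < 0" using assms(2) by (simp add: power_less_zero_eq)
  with s(2) have "A * slope s 0 < 0" by (simp only: zero_less_mult_iff[of "A * slope s 0"]) simp
  with s(1) show ?thesis by (rule that)
qed

text \<open>
  Here slope s 0 / (w \<bullet> r' s) behaves like a positive multiple of (s - m)^2, so it takes only values of
  one sign near m: there is no equilibrium for t < 0, and there are equilibria for t > 0.
\<close>

lemma generic_crossing_N0:
  assumes s2: "slope2 m 0 \<noteq> 0" and pos: "slope2 m 0 * (w \<bullet> r1 m) > 0"
  shows "\<forall>\<^sub>F t in at_left 0. N0 r I (t *\<^sub>R w) = 0"
    and "is_Theta (at_right 0) (\<lambda>t. N0 r I (t *\<^sub>R w)) (\<lambda>t. 1 / sqrt t)"
proof -
  define A where "A = slope2 m 0 / 2"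
  have f: "slope_order 2 A" unfolding A_def by (rule order_two[OF s2])
  have w: "w \<bullet> r1 m \<noteq> 0" using pos by auto
  have AB: "A * (w \<bullet> r1 m) > 0" using pos by (simp add: A_def)
  have e: "1 / 2 = (real 2 - 1) / (real 2 - real 0)" by simp
  obtain c C \<delta> where "c > 0" "C > 0" and \<delta>: "\<delta> > 0"
    and "\<And>t. \<bar>t\<bar> < \<delta> \<Longrightarrow> \<exists>X. finite X \<and> card X \<le> 3 \<and> (\<forall>s\<in>I. slope s (t *\<^sub>R w) = 0 \<longrightarrow> s \<in> X)"
    and size: "\<And>t s. \<bar>t\<bar> < \<delta> \<Longrightarrow> s \<in> I \<Longrightarrow> slope s (t *\<^sub>R w) = 0 \<Longrightarrow> s \<noteq> m \<Longrightarrow>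
       c * \<bar>t\<bar> powr (1 / 2) \<le> \<bar>slope1 s (t *\<^sub>R w)\<bar> \<and>
       \<bar>slope1 s (t *\<^sub>R w)\<bar> \<le> C * \<bar>t\<bar> powr (1 / 2) \<and>
       A * (w \<bullet> r1 m) * t * (s - m) ^ (2 - 0) > 0"
    by (rule equilibria_near_m[OF f component_order_zero[OF w] _ e]) (simp, rule that)
  have small: "\<forall>\<^sub>F t in at_left 0. t < 0 \<and> \<bar>t\<bar> < \<delta>"
    using eventually_abs_small[OF \<delta>] by (auto simp: eventually_at_filter elim: eventually_mono)
  then show "\<forall>\<^sub>F t in at_left 0. N0 r I (t *\<^sub>R w) = 0"
  proof eventually_elim
    case (elim t)
    have "slope s (t *\<^sub>R w) \<noteq> 0" if "s \<in> I" for s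
    proof
      assume 0: "slope s (t *\<^sub>R w) = 0"
      then have "s \<noteq> m" using elim w by (auto simp: slope_line)
      then have "A * (w \<bullet> r1 m) * t * (s - m) ^ (2 - 0) > 0" using size[OF _ that 0] elim by blast
      moreover have "A * (w \<bullet> r1 m) * t < 0" using AB elim by (simp only: mult_pos_neg)
      from mult_nonpos_nonneg[OF less_imp_le[OF this] zero_le_power2]
      have "A * (w \<bullet> r1 m) * t * (s - m) ^ (2 - 0) \<le> 0" by (simp only: diff_zero)
      then have "\<not> A * (w \<bullet> r1 m) * t * (s - m) ^ (2 - 0) > 0" by (simp only: not_less)
      ultimately show False by blast
    qed
    then have "equilibria r I (t *\<^sub>R w) = {}" by (auto simp: equilibria_eq)
    then show ?case by (simp add: N0_def)
  qed
  obtain s1 where s1: "s1 \<in> I" "A * slope s1 0 > 0" using slope_right_of_m[OF f] .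
  have "slope s1 0 \<noteq> 0" using s1 by auto
  from equilibrium_exists[OF s1(1) this, of w] obtain \<delta>' where \<delta>': "\<delta>' > 0"
    "\<And>t. \<bar>t\<bar> < \<delta>' \<Longrightarrow> slope s1 0 * (t * (w \<bullet> r1 m)) > 0 \<Longrightarrow> \<exists>s\<in>I. slope s (t *\<^sub>R w) = 0" by blast
  have S: "slope s1 0 * (w \<bullet> r1 m) > 0" using s1(2) AB by (auto simp: zero_less_mult_iff)
  have small': "\<forall>\<^sub>F t in at_right 0. 0 < t \<and> \<bar>t\<bar> < \<delta>'"
    using eventually_abs_small[OF \<delta>'(1)] by (auto simp: eventually_at_filter elim: eventually_mono)
  have "is_Theta (at_right 0) (\<lambda>t. N0 r I (t *\<^sub>R w)) (\<lambda>t. 1 / \<bar>t\<bar> powr ((real 2 - 1) / real 2))"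
  proof (rule transversal_N0_Theta[OF f w])
    show "at_right 0 \<le> at (0::real)" by (simp add: at_le)
    show "\<forall>\<^sub>F t in at_right 0. \<exists>s\<in>I. slope s (t *\<^sub>R w) = 0"
      using small'
    proof eventually_elim
      case (elim t)
      have "t * (slope s1 0 * (w \<bullet> r1 m)) > 0" using elim S by (simp only: mult_pos_pos)
      then show ?case using \<delta>'(2)[of t] elim by (simp only: mult.left_commute)
    qed
  qed
  then obtain C1 C2 where C: "C1 > 0" "C2 > 0" "\<forall>\<^sub>F t in at_right 0.
      ennreal (C1 * (1 / \<bar>t\<bar> powr ((real 2 - 1) / real 2))) \<le> N0 r I (t *\<^sub>R w) \<and>
      N0 r I (t *\<^sub>R w) \<le> ennreal (C2 * (1 / \<bar>t\<bar> powr ((real 2 - 1) / real 2)))"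
    unfolding is_Theta_def by blast
  have "\<forall>\<^sub>F t in at_right 0. ennreal (C1 * (1 / sqrt t)) \<le> N0 r I (t *\<^sub>R w) \<and>
      N0 r I (t *\<^sub>R w) \<le> ennreal (C2 * (1 / sqrt t))"
    using C(3) small' by eventually_elim (simp add: powr_half_sqrt)
  with C(1,2) show "is_Theta (at_right 0) (\<lambda>t. N0 r I (t *\<^sub>R w)) (\<lambda>t. 1 / sqrt t)"
    unfolding is_Theta_def by blast
qed

text \<open>
  At a cusp the slope changes sign at m, so for either sign of t there is an equilibrium on one of the
  two sides of m.
\<close>

lemma cusp_transversal_N0:
  assumes s3: "slope2 m 0 = 0" "slope3 m 0 \<noteq> 0" and w: "w \<bullet> r1 m \<noteq> 0"
  shows "is_Theta (at 0) (\<lambda>t. N0 r I (t *\<^sub>R w)) (\<lambda>t. 1 / root 3 (t\<^sup>2))"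
proof -
  define A where "A = slope3 m 0 / 6"
  have f: "slope_order 3 A" unfolding A_def by (rule order_three[OF s3])
  obtain s1 where s1: "s1 \<in> I" "A * slope s1 0 > 0" using slope_right_of_m[OF f] .
  obtain s2 where s2: "s2 \<in> I" "A * slope s2 0 < 0" using slope_left_of_m[OF f] by auto
  have nz: "slope s1 0 \<noteq> 0" "slope s2 0 \<noteq> 0" using s1 s2 by auto
  have opposite: "slope s1 0 > 0 \<and> slope s2 0 < 0 \<or> slope s1 0 < 0 \<and> slope s2 0 > 0"
    using s1(2) s2(2) by (cases "A > 0") (simp_all add: zero_less_mult_iff mult_less_0_iff)
  obtain \<delta>1 where \<delta>1: "\<delta>1 > 0"
    "\<And>t. \<bar>t\<bar> < \<delta>1 \<Longrightarrow> slope s1 0 * (t * (w \<bullet> r1 m)) > 0 \<Longrightarrow> \<exists>s\<in>I. slope s (t *\<^sub>R w) = 0"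
    using equilibrium_exists[OF s1(1) nz(1), of w] by blast
  obtain \<delta>2 where \<delta>2: "\<delta>2 > 0"
    "\<And>t. \<bar>t\<bar> < \<delta>2 \<Longrightarrow> slope s2 0 * (t * (w \<bullet> r1 m)) > 0 \<Longrightarrow> \<exists>s\<in>I. slope s (t *\<^sub>R w) = 0"
    using equilibrium_exists[OF s2(1) nz(2), of w] by blast
  have powr_two_thirds: "\<bar>t\<bar> powr (2 / 3) = root 3 (t\<^sup>2)" if "t \<noteq> 0" for t :: real
  proof -
    have square: "t\<^sup>2 = \<bar>t\<bar> powr 2" using that by (simp add: powr_numeral)
    have "root 3 (t\<^sup>2) = (t\<^sup>2) powr (1 / 3)" using that by (simp add: root_powr_inverse)
    also have "\<dots> = (\<bar>t\<bar> powr 2) powr (1 / 3)" by (simp only: square)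
    also have "\<dots> = \<bar>t\<bar> powr (2 / 3)" by (subst powr_powr) simp
    finally show ?thesis by (rule sym)
  qed
  have exponent: "1 / \<bar>t\<bar> powr ((real 3 - 1) / real 3) = 1 / root 3 (t\<^sup>2)" for t :: real
    by (cases "t = 0") (auto simp: powr_two_thirds)
  have "is_Theta (at 0) (\<lambda>t. N0 r I (t *\<^sub>R w)) (\<lambda>t. 1 / \<bar>t\<bar> powr ((real 3 - 1) / real 3))"
  proof (rule transversal_N0_Theta[OF f w order_refl])
    show "\<forall>\<^sub>F t in at 0. \<exists>s\<in>I. slope s (t *\<^sub>R w) = 0"
      using eventually_abs_small[OF \<delta>1(1)] eventually_abs_small[OF \<delta>2(1)]
    proof eventually_elim
      case (elim t)
      define T where "T = t * (w \<bullet> r1 m)"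
      have "T \<noteq> 0" using elim w by (simp add: T_def)
      then consider "T > 0" | "T < 0" by linarith
      then have "slope s1 0 * T > 0 \<or> slope s2 0 * T > 0"
        using opposite by cases (auto intro: mult_pos_pos mult_neg_neg)
      then have "slope s1 0 * (t * (w \<bullet> r1 m)) > 0 \<or> slope s2 0 * (t * (w \<bullet> r1 m)) > 0"
        by (simp only: T_def)
      with \<delta>1(2) \<delta>2(2) elim show ?case by blast
    qed
  qed
  then show ?thesis unfolding exponent .
qed

end

section \<open>The four asymptotic laws\<close>

lemma Ck_on_SucD:
  "Ck_on (Suc k) f I \<Longrightarrow> \<exists>f'. (\<forall>s\<in>I. (f has_vector_derivative f' s) (at s within I)) \<and> Ck_on k f' I"
  by simp

theorem theorem5:
  fixes r :: "real \<Rightarrow> real \<times> real" and a b m \<mu> \<nu> :: real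
  defines "I \<equiv> {a..b}"
  defines "p \<equiv> (\<lambda>t::real. (\<mu> * t, \<nu> * t))"
  defines "N \<equiv> (\<lambda>t. N0 r I (p t))"
  assumes curve: "regular_Ck_curve 4 r I"
    and interior: "a < m" "m < b"
    and unique: "equilibria r I (0, 0) = {m}"
    and degenerate: "degenerate r I (0, 0) m"
    and direction: "(\<mu>, \<nu>) \<noteq> (0, 0)"
  shows
    "(generic_evolute_point r I m \<and>
      (\<exists>V A B. evolute_sides r I m V A B \<and>
         (\<forall>\<^sub>F t in at_left 0. p t \<in> A) \<and> (\<forall>\<^sub>F t in at_right 0. p t \<in> B))
      \<longrightarrow> (\<forall>\<^sub>F t in at_left 0. N t = 0) \<and> is_Theta (at_right 0) N (\<lambda>t. 1 / sqrt t))
   \<and> (generic_evolute_point r I m \<and> evolute_locally_convex r I m \<and> evolute_tangent r I m (\<mu>, \<nu>)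
      \<longrightarrow> is_Theta (at 0) N (\<lambda>t. 1 / \<bar>t\<bar>))
   \<and> (generic_evolute_cusp r I m \<and> \<not> evolute_tangent r I m (\<mu>, \<nu>)
      \<longrightarrow> is_Theta (at 0) N (\<lambda>t. 1 / root 3 (t\<^sup>2)))
   \<and> (generic_evolute_cusp r I m \<and> evolute_tangent r I m (\<mu>, \<nu>)
      \<longrightarrow> is_Theta (at 0) N (\<lambda>t. 1 / \<bar>t\<bar>))"
proof -
  have "(4::nat) = Suc (Suc (Suc (Suc 0)))" by simp
  then have smooth: "Ck_on (Suc (Suc (Suc (Suc 0)))) r I"
    using curve unfolding regular_Ck_curve_def by metis
  have vel: "\<And>s. s \<in> I \<Longrightarrow> velocity r I s \<noteq> 0"
    using curve unfolding regular_Ck_curve_def by blast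
  obtain r1 where
    r1: "\<forall>s\<in>I. (r has_vector_derivative r1 s) (at s within I)" "Ck_on (Suc (Suc (Suc 0))) r1 I"
    using Ck_on_SucD[OF smooth] by blast
  obtain r2 where
    r2: "\<forall>s\<in>I. (r1 has_vector_derivative r2 s) (at s within I)" "Ck_on (Suc (Suc 0)) r2 I"
    using Ck_on_SucD[OF r1(2)] by blast
  obtain r3 where
    r3: "\<forall>s\<in>I. (r2 has_vector_derivative r3 s) (at s within I)" "Ck_on (Suc 0) r3 I"
    using Ck_on_SucD[OF r2(2)] by blast
  obtain r4 where
    r4: "\<forall>s\<in>I. (r3 has_vector_derivative r4 s) (at s within I)"
    using Ck_on_SucD[OF r3(2)] by blast
  note D = r1(1) r2(1) r3(1) r4
  have "a < b" using interior by simp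
  have "r1 s \<noteq> 0" if "s \<in> I" for s
    using vector_derivative_within_cbox[OF \<open>a < b\<close>, where f = r and x = s] D(1)[rule_format, OF that] vel[OF that] that
    by (simp add: velocity_def I_def)
  then interpret degenerate_arc r r1 r2 r3 r4 a b m
    using D \<open>a < b\<close> interior unique degenerate
    by unfold_locales (auto simp: I_def zero_prod_def)
  define w where "w = (\<mu>, \<nu>)"
  have w: "w \<noteq> 0" using direction by (simp add: w_def zero_prod_def)
  have p: "p = (\<lambda>t. t *\<^sub>R w)" by (simp add: p_def w_def fun_eq_iff mult.commute)
  have N: "N = (\<lambda>t. N0 r {a..b} (t *\<^sub>R w))" by (simp add: N_def p I_def)
  have crossing: "(\<forall>\<^sub>F t in at_left 0. N t = 0) \<and> is_Theta (at_right 0) N (\<lambda>t. 1 / sqrt t)"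
    if "generic_evolute_point r I m" "evolute_sides r I m V A B"
      "\<forall>\<^sub>F t in at_left 0. p t \<in> A" "\<forall>\<^sub>F t in at_right 0. p t \<in> B" for V A B
  proof -
    have s2: "slope2 m 0 \<noteq> 0" by (rule generic_point_slope2[OF that(1)[unfolded I_def]])
    have "slope2 m 0 * (w \<bullet> r1 m) > 0"
      by (rule evolute_sides_crossing[OF s2 w that(2-4)[unfolded I_def p]])
    from generic_crossing_N0[OF s2 this] show ?thesis by (simp only: N)
  qed
  have generic_tangent: "is_Theta (at 0) N (\<lambda>t. 1 / \<bar>t\<bar>)"
    if "generic_evolute_point r I m" "evolute_tangent r I m (\<mu>, \<nu>)"
  proof -
    have s2: "slope2 m 0 \<noteq> 0" by (rule generic_point_slope2[OF that(1)[unfolded I_def]])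
    have "w \<bullet> r1 m = 0"
      using evolute_tangent_iff[OF order_two[OF s2] w] that(2) unfolding I_def w_def by blast
    from tangent_N0_Theta[OF order_two[OF s2] w this] show ?thesis by (simp only: N)
  qed
  have cusp_transversal: "is_Theta (at 0) N (\<lambda>t. 1 / root 3 (t\<^sup>2))"
    if "generic_evolute_cusp r I m" "\<not> evolute_tangent r I m (\<mu>, \<nu>)"
  proof -
    have s3: "slope2 m 0 = 0" "slope3 m 0 \<noteq> 0"
      by (rule generic_cusp_slopes[OF that(1)[unfolded I_def]])+
    have "w \<bullet> r1 m \<noteq> 0"
      using evolute_tangent_iff[OF order_three[OF s3] w] that(2) unfolding I_def w_def by blast
    from cusp_transversal_N0[OF s3 this] show ?thesis by (simp only: N)
  qed
  have cusp_tangent: "is_Theta (at 0) N (\<lambda>t. 1 / \<bar>t\<bar>)"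
    if "generic_evolute_cusp r I m" "evolute_tangent r I m (\<mu>, \<nu>)"
  proof -
    have s3: "slope2 m 0 = 0" "slope3 m 0 \<noteq> 0"
      by (rule generic_cusp_slopes[OF that(1)[unfolded I_def]])+
    have "w \<bullet> r1 m = 0"
      using evolute_tangent_iff[OF order_three[OF s3] w] that(2) unfolding I_def w_def by blast
    from tangent_N0_Theta[OF order_three[OF s3] w this] show ?thesis by (simp only: N)
  qed
  show ?thesis
    using crossing generic_tangent cusp_transversal cusp_tangent by blast
qed

end
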